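(* Let $f=\frac1n\sum_{i=1}^n f_i:\mathbb{R}^d\to\mathbb{R}$, where each $f_i:\mathbb{R}^d\to\mathbb{R}$ is twice differentiable. Suppose there is a constant $L>0$ such that $\|\nabla^2 f(x)-\nabla^2 f(y)\|\le L\|x-y\|$ for all $x,y\in\mathbb{R}^d$, and suppose $f^*:=\inf_{x\in\mathbb{R}^d}f(x)>-\infty$. Run the C2EDEN method (described in the context) from an initial point $x_0\in\mathbb{R}^d$ with regularization parameter $M=12dL$, and let $x_d=x_0,x_{d+1},x_{d+2},\dots$ be its iterates. Then, for every integer $K>d$, $$\min_{d<i\le K}\gamma(x_i)\le \frac{f(x_0)-f^*}{K-d},$$ where $$\gamma(x)=\max\left\{-\frac{1}{648M^2}\,\lambda_{\min}\big(\nabla^2 f(x)\big)^3,\ \frac{1}{72\sqrt{2M}}\,\|\nabla f(x)\|^{3/2}\right\}.$$ Consequently, one can choose the number of iterations $K=\mathcal{O}\big(\sqrt{dL}\,\epsilon^{-3/2}\big)$ such that there exists an index $i$ with $d<i\le K$ satisfying $$\|\nabla f(x_i)\|\le\epsilon\qquad\text{and}\qquad \lambda_{\min}\big(\nabla^2 f(x_i)\big)\ge-\sqrt{dL\epsilon}.$$ Here the $\mathcal{O}$-statement means: there is a constant $C$ depending only on $f(x_0)-f^*$ such that for all sufficiently small $\epsilon>0$ a choice $K\le C\sqrt{dL}\,\epsilon^{-3/2}$ works.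
   Context: $\|\cdot\|$ is the Euclidean norm for vectors and the spectral norm for matrices; $\lambda_{\min}(\cdot)$ is the smallest eigenvalue of a symmetric matrix; $e_1,\dots,e_d$ is the standard basis of $\mathbb{R}^d$; $k\%d$ is the remainder of $k$ divided by $d$. Cubic step: for $g\in\mathbb{R}^d$, a symmetric matrix $A\in\mathbb{R}^{d\times d}$ and $x\in\mathbb{R}^d$, $$T_M(g,A;x)=\arg\min_{y\in\mathbb{R}^d}\left\{\langle g,y-x\rangle+\tfrac12\langle A(y-x),y-x\rangle+\tfrac M6\|y-x\|^3\right\}$$ denotes a (global) minimizer. C2EDEN method with input $x_0$, $M$: First, for $k=0,\dots,d-1$, the $i$-th client computes $v_{i,k}=\nabla^2 f_i(x_0)e_{k+1}$ and the server sets the $(k+1)$-th column of a matrix $H^+$ to $\frac1n\sum_{i}v_{i,k}$. Set $x_d=x_0$. Then for $k=d,d+1,\dots$: if $k\%d=0$, the server sets $\tilde x=x_k$ and $H=H^+$; each client $i$ computes and sends $v_{i,k}=\nabla^2 f_i(\tilde x)e_{k\%d+1}$ and $g_{i,k}=\nabla f_i(x_k)$; the server sets $g_k=\frac1n\sum_i g_{i,k}$ and $x_{k+1}=T_M(g_k,H;x_k)$, and overwrites the $(k\%d+1)$-th column of $H^+$ with $\frac1n\sum_i v_{i,k}$. Equivalently, $x_d=x_0$ and for all $k\ge d$, $$x_{k+1}=T_M\big(\nabla f(x_k),\nabla^2 f(x_{\tau(k;d)});x_k\big),\qquad \tau(k;d)=d\big(\lfloor k/d\rfloor-1\big).$$ 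*)

theory Defs
  imports Complex_Main "Jordan_Normal_Form.Char_Poly"
begin

text \<open>The constant hidden in the \<open>O\<close>-bound must not depend on the dimension \<open>d\<close>, so \<open>d\<close> has
  to be quantified inside the statement. Hence \<open>\<real>\<^sup>d\<close> is \<open>carrier_vec d\<close>, not a type \<open>real ^ 'n\<close>,
  and functions on \<open>\<real>\<^sup>d\<close> are functions on \<open>real vec\<close> whose values outside \<open>carrier_vec d\<close> are
  never used. Vectors and matrices are indexed from 0: \<open>unit_vec d k\<close> is the standard basis vector
  usually written \<open>e\<^bsub>k+1\<^esub>\<close>. As \<open>real vec\<close> is not a normed type, norms and Frechet
  derivatives are spelled out.\<close>

definition vnorm :: "real vec \<Rightarrow> real" where
  "vnorm v = sqrt (v \<bullet> v)"

definition spectral_norm :: "nat \<Rightarrow> real mat \<Rightarrow> real" where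
  "spectral_norm d A = Sup {vnorm (A *\<^sub>v v) | v. v \<in> carrier_vec d \<and> vnorm v \<le> 1}"

definition lambda_min :: "real mat \<Rightarrow> real" where
  "lambda_min A = Min {k. eigenvalue A k}"

definition has_gradient :: "nat \<Rightarrow> (real vec \<Rightarrow> real) \<Rightarrow> real vec \<Rightarrow> real vec \<Rightarrow> bool" where
  "has_gradient d f g x \<longleftrightarrow> g \<in> carrier_vec d \<and>
     (\<forall>e>0. \<exists>\<delta>>0. \<forall>h\<in>carrier_vec d. vnorm h < \<delta> \<longrightarrow>
        \<bar>f (x + h) - f x - g \<bullet> h\<bar> \<le> e * vnorm h)"

definition has_jacobian :: "nat \<Rightarrow> (real vec \<Rightarrow> real vec) \<Rightarrow> real mat \<Rightarrow> real vec \<Rightarrow> bool" where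
  "has_jacobian d G A x \<longleftrightarrow> A \<in> carrier_mat d d \<and>
     (\<forall>e>0. \<exists>\<delta>>0. \<forall>h\<in>carrier_vec d. vnorm h < \<delta> \<longrightarrow>
        vnorm (G (x + h) - G x - A *\<^sub>v h) \<le> e * vnorm h)"

definition grad :: "nat \<Rightarrow> (real vec \<Rightarrow> real) \<Rightarrow> real vec \<Rightarrow> real vec" where
  "grad d f x = (THE g. has_gradient d f g x)"

definition hess :: "nat \<Rightarrow> (real vec \<Rightarrow> real) \<Rightarrow> real vec \<Rightarrow> real mat" where
  "hess d f x = (THE A. has_jacobian d (grad d f) A x)"

definition twice_differentiable :: "nat \<Rightarrow> (real vec \<Rightarrow> real) \<Rightarrow> bool" where
  "twice_differentiable d f \<longleftrightarrow>
     (\<forall>x\<in>carrier_vec d. (\<exists>g. has_gradient d f g x) \<and> (\<exists>A. has_jacobian d (grad d f) A x))"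

definition lipschitz_hessian :: "nat \<Rightarrow> real \<Rightarrow> (real vec \<Rightarrow> real) \<Rightarrow> bool" where
  "lipschitz_hessian d L f \<longleftrightarrow>
     (\<forall>x\<in>carrier_vec d. \<forall>y\<in>carrier_vec d.
        spectral_norm d (hess d f x - hess d f y) \<le> L * vnorm (x - y))"

definition objective :: "nat \<Rightarrow> (nat \<Rightarrow> real vec \<Rightarrow> real) \<Rightarrow> real vec \<Rightarrow> real" where
  "objective n F x = 1 / real n * (\<Sum>i=1..n. F i x)"

definition problem_instance :: "nat \<Rightarrow> nat \<Rightarrow> (nat \<Rightarrow> real vec \<Rightarrow> real) \<Rightarrow> real \<Rightarrow> bool" where
  "problem_instance d n F L \<longleftrightarrow>
     1 \<le> d \<and> 1 \<le> n \<and> 0 < L \<and>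
     (\<forall>i\<in>{1..n}. twice_differentiable d (F i)) \<and>
     lipschitz_hessian d L (objective n F) \<and>
     bdd_below (objective n F ` carrier_vec d)"

definition f_star :: "nat \<Rightarrow> (real vec \<Rightarrow> real) \<Rightarrow> real" where
  "f_star d f = Inf (f ` carrier_vec d)"

definition cubic_model :: "real \<Rightarrow> real vec \<Rightarrow> real mat \<Rightarrow> real vec \<Rightarrow> real vec \<Rightarrow> real" where
  "cubic_model M g A x y =
     g \<bullet> (y - x) + 1 / 2 * ((A *\<^sub>v (y - x)) \<bullet> (y - x)) + M / 6 * vnorm (y - x) ^ 3"

text \<open>The cubic step is set-valued, since the global minimizer need not be unique:
  \<open>cubic_step d M g A x y\<close> says that \<open>y\<close> is an admissible value of \<open>T\<^sub>M(g, A; x)\<close>.\<close>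

definition cubic_step :: "nat \<Rightarrow> real \<Rightarrow> real vec \<Rightarrow> real mat \<Rightarrow> real vec \<Rightarrow> real vec \<Rightarrow> bool" where
  "cubic_step d M g A x y \<longleftrightarrow> is_arg_min (cubic_model M g A x) (\<lambda>z. z \<in> carrier_vec d) y"

definition client_mean :: "nat \<Rightarrow> nat \<Rightarrow> (nat \<Rightarrow> real vec) \<Rightarrow> real vec" where
  "client_mean d n w = vec d (\<lambda>j. 1 / real n * (\<Sum>i=1..n. w i $ j))"

definition mean_hess_col ::
  "nat \<Rightarrow> nat \<Rightarrow> (nat \<Rightarrow> real vec \<Rightarrow> real) \<Rightarrow> real vec \<Rightarrow> nat \<Rightarrow> real vec" where
  "mean_hess_col d n F z c = client_mean d n (\<lambda>i. hess d (F i) z *\<^sub>v unit_vec d c)"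

text \<open>\<open>c2eden d n F M x0 x\<close>: the sequence \<open>x d, x (d + 1), \<dots>\<close> is a possible output of the method
  (entries below index \<open>d\<close> are irrelevant). \<open>Hp k\<close> is the matrix \<open>H\<^sup>+\<close> at the beginning of
  iteration \<open>k\<close>, whereas \<open>xt k\<close> and \<open>H k\<close> are the values of \<open>x~\<close> and \<open>H\<close> used in iteration \<open>k\<close>,
  i.e. after the conditional refresh. The refresh always happens at \<open>k = d\<close>, so the values
  at \<open>k - 1\<close> are only read for \<open>k > d\<close>.\<close>

definition c2eden ::
  "nat \<Rightarrow> nat \<Rightarrow> (nat \<Rightarrow> real vec \<Rightarrow> real) \<Rightarrow> real \<Rightarrow> real vec \<Rightarrow> (nat \<Rightarrow> real vec) \<Rightarrow> bool" where
  "c2eden d n F M x0 x \<longleftrightarrow>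
     (\<exists>(xt :: nat \<Rightarrow> real vec) (H :: nat \<Rightarrow> real mat) (Hp :: nat \<Rightarrow> real mat).
        Hp d = mat_of_cols d (map (mean_hess_col d n F x0) [0..<d]) \<and>
        x d = x0 \<and>
        (\<forall>k\<ge>d.
           xt k = (if k mod d = 0 then x k else xt (k - 1)) \<and>
           H k = (if k mod d = 0 then Hp k else H (k - 1)) \<and>
           cubic_step d M (client_mean d n (\<lambda>i. grad d (F i) (x k))) (H k) (x k) (x (Suc k)) \<and>
           Hp (Suc k) = replace_col (Hp k) (mean_hess_col d n F (xt k) (k mod d)) (k mod d)))"

definition progress_measure :: "nat \<Rightarrow> real \<Rightarrow> (real vec \<Rightarrow> real) \<Rightarrow> real vec \<Rightarrow> real" where
  "progress_measure d M f x =
     max (- (1 / (648 * M\<^sup>2)) * lambda_min (hess d f x) ^ 3)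
         (1 / (72 * sqrt (2 * M)) * vnorm (grad d f x) powr (3 / 2))"

end

theory Submission
  imports Defs "Jordan_Normal_Form.Spectral_Radius" "HOL-Analysis.L2_Norm"
begin

text \<open>Let \<open>r\<^sub>k\<close> be the length of step \<open>k\<close> and \<open>D\<^sub>k\<close> the distance from \<open>x\<^sub>k\<close> to the point where its
  Hessian was computed. The optimality conditions of the cubic step bound
  \<open>f(x\<^sub>k) - f(x\<^bsub>k+1\<^esub>)\<close> from below by \<open>\<gamma>(x\<^bsub>k+1\<^esub>)\<close> plus \<open>49M/250\<close> times \<open>r\<^sub>k\<^sup>3\<close>, minus \<open>49M/2000\<close>
  times the cube of \<open>D\<^sub>k / d\<close>. Now \<open>D\<^sub>k\<close> is at most the sum of fewer than \<open>2d\<close> preceding step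
  lengths, and each step enters fewer than \<open>2d\<close> of these sums; by convexity of the cube the cubes of
  \<open>D\<^sub>k / d\<close> sum to at most 8 times the sum of the \<open>r\<^sub>k\<^sup>3\<close>. So the error from the stale Hessians is
  absorbed and the decrease of \<open>f\<close> telescopes.\<close>

section \<open>Norms and eigenvalues\<close>

text \<open>The factor \<open>d\<close> in \<open>M = 12 * d * L\<close> is forced by the age of the
  Hessians. A stale Hessian costs the descent a term \<open>L * D * r^2 / 2\<close>, where
  \<open>D\<close> may collect almost \<open>2 * d\<close> steps. With \<open>s = D / d\<close> the
  cost becomes \<open>M * s * r^2 / 24\<close>, and every estimate is \<open>M\<close> times a form
  of degree 3 in \<open>r\<close> and \<open>s\<close> whose coefficients do not involve
  \<open>d\<close>; only numerical constants remain to be balanced. Global minimality of the cubic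
  step matters: it gives the curvature bound \<open>- (M / 2) * r\<close> for the Hessian in use,
  whereas local minimality would leave an additional term in the direction of the step. Symmetry of
  the Hessian has to be derived, here from the Lipschitz bound. The optimality conditions rest on
  it, and so does the existence of a real eigenvalue, without which \<open>lambda_min\<close> would
  be unspecified. As that bound concerns only the mean of the clients, the analysis is carried out
  for the mean, once its gradient and Hessian are known to be the means of those of the
  clients.\<close>

lemma vnorm_eq_L2_set: "vnorm v = L2_set (\<lambda>i. v $ i) {0..<dim_vec v}"
  by (simp add: vnorm_def L2_set_def scalar_prod_def power2_eq_square)

lemma vnorm_nonneg [simp]: "0 \<le> vnorm v"
  by (simp add: vnorm_eq_L2_set)

lemma vnorm_sq: "(vnorm v)\<^sup>2 = v \<bullet> v"
  unfolding vnorm_def by (rule real_sqrt_pow2) (simp add: scalar_prod_def sum_nonneg)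

lemma vnorm_smult: "vnorm (a \<cdot>\<^sub>v v) = \<bar>a\<bar> * vnorm v"
  by (simp add: vnorm_def real_sqrt_mult)

lemma vnorm_eq_0_iff:
  assumes "v \<in> carrier_vec d"
  shows "vnorm v = 0 \<longleftrightarrow> v = 0\<^sub>v d"
  using assms by (auto simp: vnorm_eq_L2_set L2_set_eq_0_iff intro!: eq_vecI)

lemma abs_scalar_prod_le_vnorm:
  assumes "u \<in> carrier_vec d" "v \<in> carrier_vec d"
  shows "\<bar>u \<bullet> v\<bar> \<le> vnorm u * vnorm v"
proof -
  have "\<bar>u \<bullet> v\<bar> \<le> (\<Sum>i\<in>{0..<d}. \<bar>u $ i\<bar> * \<bar>v $ i\<bar>)"
    using assms sum_abs[of "\<lambda>i. u $ i * v $ i" "{0..<d}"]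
    by (simp add: scalar_prod_def abs_mult)
  also have "\<dots> \<le> vnorm u * vnorm v"
    using assms L2_set_mult_ineq[of "\<lambda>i. u $ i" "\<lambda>i. v $ i" "{0..<d}"]
    by (simp add: vnorm_eq_L2_set)
  finally show ?thesis .
qed

lemma vnorm_triangle:
  assumes "u \<in> carrier_vec d" "v \<in> carrier_vec d"
  shows "vnorm (u + v) \<le> vnorm u + vnorm v"
  using assms L2_set_triangle_ineq[of "\<lambda>i. u $ i" "\<lambda>i. v $ i" "{0..<d}"]
  by (simp add: vnorm_eq_L2_set L2_set_def)

lemma vnorm_le_sum_abs:
  assumes "v \<in> carrier_vec d"
  shows "vnorm v \<le> (\<Sum>i<d. \<bar>v $ i\<bar>)"
  using assms L2_set_le_sum_abs[of "\<lambda>i. v $ i" "{0..<d}"]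
  by (simp add: vnorm_eq_L2_set lessThan_atLeast0)

lemma abs_index_le_vnorm:
  assumes "v \<in> carrier_vec d" "i < d"
  shows "\<bar>v $ i\<bar> \<le> vnorm v"
  using assms member_le_L2_set[of "{0..<d}" i "\<lambda>i. \<bar>v $ i\<bar>"]
  by (simp add: vnorm_eq_L2_set L2_set_def)

text \<open>Any finite constant will do: it makes the set in \<open>spectral_norm\<close> bounded
  above, so that its \<open>Sup\<close> is a genuine supremum.\<close>

lemma vnorm_mult_mat_vec_bounded:
  assumes A: "A \<in> carrier_mat d d"
  shows "\<exists>C. \<forall>v\<in>carrier_vec d. vnorm (A *\<^sub>v v) \<le> C * vnorm v"
proof (intro exI ballI)
  fix v :: "real vec" assume v: "v \<in> carrier_vec d"
  have "vnorm (A *\<^sub>v v) \<le> (\<Sum>i<d. \<bar>(A *\<^sub>v v) $ i\<bar>)"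
    using A v by (intro vnorm_le_sum_abs) auto
  also have "\<dots> \<le> (\<Sum>i<d. vnorm (row A i) * vnorm v)"
    using A v by (intro sum_mono) (auto intro!: abs_scalar_prod_le_vnorm)
  finally show "vnorm (A *\<^sub>v v) \<le> (\<Sum>i<d. vnorm (row A i)) * vnorm v"
    by (simp add: sum_distrib_right)
qed

lemma vnorm_mult_mat_vec_le:
  assumes A: "A \<in> carrier_mat d d" and v: "v \<in> carrier_vec d"
  shows "vnorm (A *\<^sub>v v) \<le> spectral_norm d A * vnorm v"
proof (cases "vnorm v = 0")
  case True
  obtain C where "vnorm (A *\<^sub>v v) \<le> C * vnorm v"
    using vnorm_mult_mat_vec_bounded[OF A] v by blast
  with True show ?thesis by simp
next
  case False
  then have pos: "0 < vnorm v" by (simp add: order_less_le)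
  let ?S = "{vnorm (A *\<^sub>v v) | v. v \<in> carrier_vec d \<and> vnorm v \<le> 1}"
  obtain C where C: "\<And>w. w \<in> carrier_vec d \<Longrightarrow> vnorm (A *\<^sub>v w) \<le> C * vnorm w"
    using vnorm_mult_mat_vec_bounded[OF A] by blast
  have "bdd_above ?S"
  proof (rule bdd_aboveI)
    fix y assume "y \<in> ?S"
    then obtain w where w: "w \<in> carrier_vec d" "vnorm w \<le> 1" "y = vnorm (A *\<^sub>v w)" by blast
    have "C * vnorm w \<le> \<bar>C\<bar> * 1" using w(2) by (intro mult_mono) auto
    with C[OF w(1)] w(3) show "y \<le> \<bar>C\<bar>" by simp
  qed
  moreover have "vnorm (A *\<^sub>v ((1 / vnorm v) \<cdot>\<^sub>v v)) \<in> ?S"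
    using v pos by (auto simp: vnorm_smult intro!: exI[of _ "(1 / vnorm v) \<cdot>\<^sub>v v"])
  ultimately have "vnorm (A *\<^sub>v ((1 / vnorm v) \<cdot>\<^sub>v v)) \<le> spectral_norm d A"
    unfolding spectral_norm_def by (rule cSup_upper[rotated])
  moreover have "A *\<^sub>v ((1 / vnorm v) \<cdot>\<^sub>v v) = (1 / vnorm v) \<cdot>\<^sub>v (A *\<^sub>v v)"
    using A v by (intro mult_mat_vec) auto
  ultimately show ?thesis using pos by (simp add: vnorm_smult field_simps)
qed

text \<open>Symmetry as an identity of bilinear forms: this is what expansions of \<open>f\<close>
  yield for a Hessian, and what the expansion of the cubic model consumes.\<close>

definition symmetric_form :: "nat \<Rightarrow> real mat \<Rightarrow> bool" where
  "symmetric_form d A \<longleftrightarrow>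
     (\<forall>u\<in>carrier_vec d. \<forall>v\<in>carrier_vec d. (A *\<^sub>v u) \<bullet> v = (A *\<^sub>v v) \<bullet> u)"

text \<open>A complex eigenvector \<open>a + i b\<close> exists. Comparing \<open>(A a) . b\<close>
  with \<open>(A b) . a\<close> leaves the imaginary part of the eigenvalue times
  \<open>|a|^2 + |b|^2\<close>, so the eigenvalue is real, and whichever of \<open>a\<close>,
  \<open>b\<close> is nonzero is a real eigenvector.\<close>

lemma symmetric_form_eigenvalue_exists:
  assumes A: "A \<in> carrier_mat d d" and d: "0 < d" and sym: "symmetric_form d A"
  shows "\<exists>k. eigenvalue A k"
proof -
  let ?A = "map_mat complex_of_real A"
  have A': "?A \<in> carrier_mat d d" using A by simp
  obtain l v where v: "v \<in> carrier_vec d" "v \<noteq> 0\<^sub>v d" "?A *\<^sub>v v = l \<cdot>\<^sub>v v"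
    using spectrum_non_empty[OF A' d] A'
    by (auto simp: spectrum_def eigenvalue_def eigenvector_def)
  define a b where "a = map_vec Re v" and "b = map_vec Im v"
  have ab: "a \<in> carrier_vec d" "b \<in> carrier_vec d" using v by (auto simp: a_def b_def)
  have comp: "(\<Sum>j\<in>{0..<d}. complex_of_real (A $$ (i, j)) * v $ j) = l * v $ i" if "i < d" for i
    using arg_cong[OF v(3), of "\<lambda>w. w $ i"] that A v(1) by (simp add: scalar_prod_def)
  have Aa: "A *\<^sub>v a = Re l \<cdot>\<^sub>v a - Im l \<cdot>\<^sub>v b"
    using A v(1) arg_cong[OF comp, of _ Re]
    by (intro eq_vecI) (auto simp: a_def b_def scalar_prod_def)
  have Ab: "A *\<^sub>v b = Re l \<cdot>\<^sub>v b + Im l \<cdot>\<^sub>v a"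
    using A v(1) arg_cong[OF comp, of _ Im]
    by (intro eq_vecI) (auto simp: a_def b_def scalar_prod_def)
  have "(A *\<^sub>v a) \<bullet> b = (A *\<^sub>v b) \<bullet> a"
    using sym ab by (simp add: symmetric_form_def)
  then have "Im l * ((vnorm a)\<^sup>2 + (vnorm b)\<^sup>2) = 0"
    using ab comm_scalar_prod[OF ab]
    by (simp add: Aa Ab vnorm_sq minus_scalar_prod_distrib[where n=d]
        add_scalar_prod_distrib[where n=d] algebra_simps)
  moreover have nz: "a \<noteq> 0\<^sub>v d \<or> b \<noteq> 0\<^sub>v d"
  proof (rule ccontr)
    assume "\<not> ?thesis"
    then have "Re (v $ i) = 0 \<and> Im (v $ i) = 0" if "i < d" for i
      using that v(1) index_map_vec(1)[of i v Re] index_map_vec(1)[of i v Im]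
      by (auto simp: a_def b_def)
    with v show False by (auto intro!: eq_vecI simp: complex_eq_iff)
  qed
  then have "(vnorm a)\<^sup>2 + (vnorm b)\<^sup>2 \<noteq> 0"
    using ab by (auto simp: sum_power2_eq_zero_iff vnorm_eq_0_iff)
  ultimately have "Im l = 0" by auto
  then have "A *\<^sub>v a = Re l \<cdot>\<^sub>v a" "A *\<^sub>v b = Re l \<cdot>\<^sub>v b"
    using ab by (auto simp: Aa Ab intro!: eq_vecI)
  with nz ab A show ?thesis by (auto simp: eigenvalue_def eigenvector_def)
qed

text \<open>The eigenvalues form a finite nonempty set, so the \<open>Min\<close> is itself an
  eigenvalue; the form is tested on one of its eigenvectors.\<close>

lemma lambda_min_ge:
  assumes A: "A \<in> carrier_mat d d" and d: "0 < d" and sym: "symmetric_form d A"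
    and lower: "\<And>v. v \<in> carrier_vec d \<Longrightarrow> - c * (vnorm v)\<^sup>2 \<le> (A *\<^sub>v v) \<bullet> v"
  shows "- c \<le> lambda_min A"
proof -
  have "finite {k. eigenvalue A k}"
    using card_finite_spectrum(1)[OF A] by (simp add: spectrum_def)
  moreover have "{k. eigenvalue A k} \<noteq> {}"
    using symmetric_form_eigenvalue_exists[OF A d sym] by blast
  ultimately have "lambda_min A \<in> {k. eigenvalue A k}"
    unfolding lambda_min_def by (rule Min_in)
  then obtain v where v: "v \<in> carrier_vec d" "v \<noteq> 0\<^sub>v d" "A *\<^sub>v v = lambda_min A \<cdot>\<^sub>v v"
    using A by (auto simp: eigenvalue_def eigenvector_def)
  then have "0 < (vnorm v)\<^sup>2" by (simp add: vnorm_eq_0_iff)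
  moreover have "- c * (vnorm v)\<^sup>2 \<le> lambda_min A * (vnorm v)\<^sup>2"
    using lower[OF v(1)] v by (simp add: vnorm_sq)
  ultimately show ?thesis by (metis mult_le_cancel_right_pos)
qed

section \<open>Gradients and Jacobians\<close>

text \<open>The common shape of the remainders in \<open>has_gradient\<close> and
  \<open>has_jacobian\<close>. It takes no absolute value because those remainders are already
  nonnegative.\<close>

definition little_o_norm :: "nat \<Rightarrow> (real vec \<Rightarrow> real) \<Rightarrow> bool" where
  "little_o_norm d q \<longleftrightarrow>
     (\<forall>e>0. \<exists>\<delta>>0. \<forall>h\<in>carrier_vec d. vnorm h < \<delta> \<longrightarrow> q h \<le> e * vnorm h)"

lemma has_gradient_iff:
  "has_gradient d f g x \<longleftrightarrow>
     g \<in> carrier_vec d \<and> little_o_norm d (\<lambda>h. \<bar>f (x + h) - f x - g \<bullet> h\<bar>)"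
  by (simp add: has_gradient_def little_o_norm_def)

lemma has_jacobian_iff:
  "has_jacobian d G A x \<longleftrightarrow>
     A \<in> carrier_mat d d \<and> little_o_norm d (\<lambda>h. vnorm (G (x + h) - G x - A *\<^sub>v h))"
  by (simp add: has_jacobian_def little_o_norm_def)

lemma little_o_norm_mono:
  assumes "little_o_norm d q" "\<And>h. h \<in> carrier_vec d \<Longrightarrow> p h \<le> q h"
  shows "little_o_norm d p"
  using assms unfolding little_o_norm_def by (meson order_trans)

lemma little_o_norm_cmult:
  assumes "little_o_norm d q" "0 \<le> c"
  shows "little_o_norm d (\<lambda>h. c * q h)"
  unfolding little_o_norm_def
proof (intro allI impI)
  fix e :: real assume "0 < e"
  then have "0 < e / (c + 1)" using assms(2) by simp
  then obtain \<delta> where \<delta>: "\<delta> > 0"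
    "\<And>h. h \<in> carrier_vec d \<Longrightarrow> vnorm h < \<delta> \<Longrightarrow> q h \<le> e / (c + 1) * vnorm h"
    using assms(1) unfolding little_o_norm_def by blast
  have "c * q h \<le> e * vnorm h" if "h \<in> carrier_vec d" "vnorm h < \<delta>" for h
  proof -
    have "c * q h \<le> c * (e / (c + 1) * vnorm h)"
      using \<delta>(2)[OF that] assms(2) by (rule mult_left_mono)
    also have "\<dots> = (c / (c + 1)) * (e * vnorm h)" by simp
    also have "\<dots> \<le> 1 * (e * vnorm h)"
      using assms(2) \<open>0 < e\<close> by (intro mult_right_mono) auto
    finally show ?thesis by simp
  qed
  with \<delta>(1) show "\<exists>\<delta>>0. \<forall>h\<in>carrier_vec d. vnorm h < \<delta> \<longrightarrow> c * q h \<le> e * vnorm h" by blast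
qed

lemma little_o_norm_add:
  assumes "little_o_norm d p" "little_o_norm d q"
  shows "little_o_norm d (\<lambda>h. p h + q h)"
  unfolding little_o_norm_def
proof (intro allI impI)
  fix e :: real assume "0 < e"
  then have "0 < e / 2" by simp
  obtain \<delta>1 where \<delta>1: "\<delta>1 > 0"
    "\<And>h. h \<in> carrier_vec d \<Longrightarrow> vnorm h < \<delta>1 \<Longrightarrow> p h \<le> e / 2 * vnorm h"
    using assms(1) \<open>0 < e / 2\<close> unfolding little_o_norm_def by blast
  obtain \<delta>2 where \<delta>2: "\<delta>2 > 0"
    "\<And>h. h \<in> carrier_vec d \<Longrightarrow> vnorm h < \<delta>2 \<Longrightarrow> q h \<le> e / 2 * vnorm h"
    using assms(2) \<open>0 < e / 2\<close> unfolding little_o_norm_def by blast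
  have "p h + q h \<le> e * vnorm h" if "h \<in> carrier_vec d" "vnorm h < min \<delta>1 \<delta>2" for h
    using \<delta>1(2)[of h] \<delta>2(2)[of h] that by simp
  with \<delta>1(1) \<delta>2(1) show "\<exists>\<delta>>0. \<forall>h\<in>carrier_vec d. vnorm h < \<delta> \<longrightarrow> p h + q h \<le> e * vnorm h"
    by (intro exI[of _ "min \<delta>1 \<delta>2"]) simp
qed

lemma little_o_norm_sum:
  assumes "finite I" "\<And>i. i \<in> I \<Longrightarrow> little_o_norm d (q i)"
  shows "little_o_norm d (\<lambda>h. \<Sum>i\<in>I. q i h)"
  using assms
proof (induction I rule: finite_induct)
  case empty
  then show ?case by (auto simp: little_o_norm_def intro!: exI[of _ 1])
next
  case (insert i I)
  then show ?case by (simp add: little_o_norm_add)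
qed

lemma has_gradient_imp_has_real_derivative:
  assumes grad: "has_gradient d f g (x + t \<cdot>\<^sub>v h)"
    and x: "x \<in> carrier_vec d" and h: "h \<in> carrier_vec d"
  shows "((\<lambda>s. f (x + s \<cdot>\<^sub>v h)) has_real_derivative g \<bullet> h) (at t)"
  unfolding DERIV_def LIM_eq
proof (intro allI impI)
  fix e :: real assume e: "0 < e"
  \<comment> \<open>Adding 1 keeps the divisor positive when \<open>h\<close> is zero.\<close>
  define n where "n = vnorm h + 1"
  have n: "0 < n" "vnorm h < n" by (simp_all add: n_def add_nonneg_pos)
  have "0 < e / n" using e n by simp
  then obtain \<delta> where \<delta>: "\<delta> > 0" "\<And>k. k \<in> carrier_vec d \<Longrightarrow> vnorm k < \<delta> \<Longrightarrow>
      \<bar>f (x + t \<cdot>\<^sub>v h + k) - f (x + t \<cdot>\<^sub>v h) - g \<bullet> k\<bar> \<le> e / n * vnorm k"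
    using grad unfolding has_gradient_def by blast
  have g: "g \<in> carrier_vec d" using grad by (simp add: has_gradient_def)
  have "norm ((f (x + (t + s) \<cdot>\<^sub>v h) - f (x + t \<cdot>\<^sub>v h)) / s - g \<bullet> h) < e"
    if s: "s \<noteq> 0" "norm (s - 0) < \<delta> / n" for s
  proof -
    have "vnorm (s \<cdot>\<^sub>v h) \<le> \<bar>s\<bar> * n"
      using n by (simp add: vnorm_smult mult_left_mono)
    also have "\<dots> < \<delta>" using s n by (simp add: field_simps)
    finally have "\<bar>f (x + t \<cdot>\<^sub>v h + s \<cdot>\<^sub>v h) - f (x + t \<cdot>\<^sub>v h) - g \<bullet> (s \<cdot>\<^sub>v h)\<bar>
        \<le> e / n * vnorm (s \<cdot>\<^sub>v h)"
      using h by (intro \<delta>(2)) auto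
    moreover have "x + t \<cdot>\<^sub>v h + s \<cdot>\<^sub>v h = x + (t + s) \<cdot>\<^sub>v h"
      using x h by (auto intro!: eq_vecI simp: algebra_simps)
    ultimately have le: "\<bar>f (x + (t + s) \<cdot>\<^sub>v h) - f (x + t \<cdot>\<^sub>v h) - s * (g \<bullet> h)\<bar>
        \<le> e / n * (\<bar>s\<bar> * vnorm h)"
      using g h by (simp add: vnorm_smult)
    also have "\<dots> < e * \<bar>s\<bar>"
    proof -
      have "vnorm h / n < 1" using n by simp
      then have "(e * \<bar>s\<bar>) * (vnorm h / n) < (e * \<bar>s\<bar>) * 1"
        using e s by (intro mult_strict_left_mono) auto
      then show ?thesis by (simp add: field_simps)
    qed
    finally have "\<bar>f (x + (t + s) \<cdot>\<^sub>v h) - f (x + t \<cdot>\<^sub>v h) - s * (g \<bullet> h)\<bar> / \<bar>s\<bar> < e"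
      using s by (simp add: divide_less_eq)
    moreover have "(f (x + (t + s) \<cdot>\<^sub>v h) - f (x + t \<cdot>\<^sub>v h)) / s - g \<bullet> h =
        (f (x + (t + s) \<cdot>\<^sub>v h) - f (x + t \<cdot>\<^sub>v h) - s * (g \<bullet> h)) / s"
      using s by (simp add: field_simps)
    ultimately show ?thesis by (simp add: abs_divide)
  qed
  with \<delta>(1) n show "\<exists>\<delta>>0. \<forall>s. s \<noteq> 0 \<and> norm (s - 0) < \<delta> \<longrightarrow>
      norm ((f (x + (t + s) \<cdot>\<^sub>v h) - f (x + t \<cdot>\<^sub>v h)) / s - g \<bullet> h) < e"
    by (intro exI[of _ "\<delta> / n"]) auto
qed

text \<open>Each coordinate of a gradient is the one-variable derivative along a unit vector, and
  that is unique. This gives the \<open>THE\<close> in \<open>grad\<close> its meaning.\<close>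

lemma has_gradient_unique:
  assumes "has_gradient d f g x" "has_gradient d f g' x" and x: "x \<in> carrier_vec d"
  shows "g = g'"
proof -
  have carr: "g \<in> carrier_vec d" "g' \<in> carrier_vec d"
    using assms by (auto simp: has_gradient_def)
  have zero: "x + 0 \<cdot>\<^sub>v unit_vec d i = x" for i
    using x by (auto intro!: eq_vecI)
  have "g $ i = g' $ i" if "i < d" for i
  proof -
    have "((\<lambda>s. f (x + s \<cdot>\<^sub>v unit_vec d i)) has_real_derivative g0 \<bullet> unit_vec d i) (at 0)"
      if "has_gradient d f g0 x" for g0
      using that x zero[of i] by (intro has_gradient_imp_has_real_derivative[where d=d]) simp_all
    then have "g \<bullet> unit_vec d i = g' \<bullet> unit_vec d i"
      using assms DERIV_unique by blast
    with that show ?thesis using scalar_prod_right_unit[OF that] by simp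
  qed
  with carr show ?thesis by (auto intro!: eq_vecI)
qed

lemma grad_eqI:
  assumes "has_gradient d f g x" "x \<in> carrier_vec d"
  shows "grad d f x = g"
  unfolding grad_def using assms has_gradient_unique by blast

text \<open>Pairing with a fixed \<open>w\<close> turns statements about a vector field into scalar
  ones, by Cauchy-Schwarz. Unit vectors \<open>w\<close> yield the rows of the Jacobian, hence its
  uniqueness; general \<open>w\<close> serve the Taylor estimates.\<close>

lemma has_jacobian_imp_has_gradient:
  assumes jac: "has_jacobian d G A x"
    and G: "\<And>y. y \<in> carrier_vec d \<Longrightarrow> G y \<in> carrier_vec d"
    and x: "x \<in> carrier_vec d" and w: "w \<in> carrier_vec d"
  shows "has_gradient d (\<lambda>y. G y \<bullet> w) (A\<^sup>T *\<^sub>v w) x"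
  unfolding has_gradient_iff
proof
  have A: "A \<in> carrier_mat d d" using jac by (simp add: has_jacobian_def)
  then show "A\<^sup>T *\<^sub>v w \<in> carrier_vec d" using w by auto
  have "little_o_norm d (\<lambda>h. vnorm w * vnorm (G (x + h) - G x - A *\<^sub>v h))"
    using jac by (intro little_o_norm_cmult) (auto simp: has_jacobian_iff)
  then show "little_o_norm d (\<lambda>h. \<bar>G (x + h) \<bullet> w - G x \<bullet> w - (A\<^sup>T *\<^sub>v w) \<bullet> h\<bar>)"
  proof (rule little_o_norm_mono)
    fix h :: "real vec" assume h: "h \<in> carrier_vec d"
    have carr: "G (x + h) \<in> carrier_vec d" "G x \<in> carrier_vec d" "A *\<^sub>v h \<in> carrier_vec d"
      using A h x by (auto intro!: G)
    have "(A\<^sup>T *\<^sub>v w) \<bullet> h = (A *\<^sub>v h) \<bullet> w"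
      using transpose_vec_mult_scalar[OF A h w] carr w A h
      by (metis comm_scalar_prod mult_mat_vec_carrier transpose_carrier_mat)
    then have "G (x + h) \<bullet> w - G x \<bullet> w - (A\<^sup>T *\<^sub>v w) \<bullet> h = (G (x + h) - G x - A *\<^sub>v h) \<bullet> w"
      using carr w by (simp add: minus_scalar_prod_distrib[where n=d])
    also have "\<bar>\<dots>\<bar> \<le> vnorm (G (x + h) - G x - A *\<^sub>v h) * vnorm w"
      using carr w by (intro abs_scalar_prod_le_vnorm) auto
    finally show "\<bar>G (x + h) \<bullet> w - G x \<bullet> w - (A\<^sup>T *\<^sub>v w) \<bullet> h\<bar>
        \<le> vnorm w * vnorm (G (x + h) - G x - A *\<^sub>v h)" by (simp add: mult.commute)
  qed
qed

lemma has_jacobian_imp_has_real_derivative: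
  assumes jac: "has_jacobian d G A (x + t \<cdot>\<^sub>v h)"
    and G: "\<And>y. y \<in> carrier_vec d \<Longrightarrow> G y \<in> carrier_vec d"
    and x: "x \<in> carrier_vec d" and h: "h \<in> carrier_vec d" and w: "w \<in> carrier_vec d"
  shows "((\<lambda>s. G (x + s \<cdot>\<^sub>v h) \<bullet> w) has_real_derivative (A *\<^sub>v h) \<bullet> w) (at t)"
proof -
  have A: "A \<in> carrier_mat d d" using jac by (simp add: has_jacobian_def)
  have "(A\<^sup>T *\<^sub>v w) \<bullet> h = (A *\<^sub>v h) \<bullet> w"
    using transpose_vec_mult_scalar[OF A h w] w A h
    by (metis comm_scalar_prod mult_mat_vec_carrier transpose_carrier_mat)
  moreover have "((\<lambda>s. G (x + s \<cdot>\<^sub>v h) \<bullet> w) has_real_derivative (A\<^sup>T *\<^sub>v w) \<bullet> h) (at t)"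
    using x h by (intro has_gradient_imp_has_real_derivative[where d=d]
        has_jacobian_imp_has_gradient[OF jac G _ w]) auto
  ultimately show ?thesis by simp
qed

lemma has_jacobian_unique:
  assumes jac: "has_jacobian d G A x" "has_jacobian d G B x"
    and G: "\<And>y. y \<in> carrier_vec d \<Longrightarrow> G y \<in> carrier_vec d" and x: "x \<in> carrier_vec d"
  shows "A = B"
proof -
  have carr: "A \<in> carrier_mat d d" "B \<in> carrier_mat d d"
    using jac by (auto simp: has_jacobian_def)
  have "A $$ (i, j) = B $$ (i, j)" if ij: "i < d" "j < d" for i j
  proof -
    have "A\<^sup>T *\<^sub>v unit_vec d i = B\<^sup>T *\<^sub>v unit_vec d i"
      using has_gradient_unique[OF has_jacobian_imp_has_gradient[OF jac(1) G x]
          has_jacobian_imp_has_gradient[OF jac(2) G x] x] by simp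
    then have "(A\<^sup>T *\<^sub>v unit_vec d i) $ j = (B\<^sup>T *\<^sub>v unit_vec d i) $ j" by simp
    with ij carr show ?thesis by simp
  qed
  with carr show ?thesis by (auto intro!: eq_matI)
qed

lemma has_gradient_mean:
  assumes "\<And>i. i \<in> {1..n} \<Longrightarrow> has_gradient d (F i) (g i) x"
  shows "has_gradient d (objective n F) (client_mean d n g) x"
  unfolding has_gradient_iff
proof
  show "client_mean d n g \<in> carrier_vec d" by (simp add: client_mean_def)
  have g: "g i \<in> carrier_vec d" if "i \<in> {1..n}" for i
    using assms[OF that] by (simp add: has_gradient_def)
  have "little_o_norm d (\<lambda>h. 1 / real n * (\<Sum>i=1..n. \<bar>F i (x + h) - F i x - g i \<bullet> h\<bar>))"
    using assms by (intro little_o_norm_cmult little_o_norm_sum) (auto simp: has_gradient_iff)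
  then show "little_o_norm d (\<lambda>h. \<bar>objective n F (x + h) - objective n F x - client_mean d n g \<bullet> h\<bar>)"
  proof (rule little_o_norm_mono)
    fix h :: "real vec" assume h: "h \<in> carrier_vec d"
    have "client_mean d n g \<bullet> h = 1 / real n * (\<Sum>j\<in>{0..<d}. \<Sum>i=1..n. g i $ j * h $ j)"
      using h by (simp add: client_mean_def scalar_prod_def sum_distrib_right sum_divide_distrib)
    also have "\<dots> = 1 / real n * (\<Sum>i=1..n. g i \<bullet> h)"
      using h by (subst sum.swap) (simp add: scalar_prod_def)
    finally have "objective n F (x + h) - objective n F x - client_mean d n g \<bullet> h =
        1 / real n * (\<Sum>i=1..n. F i (x + h) - F i x - g i \<bullet> h)"
      by (simp add: objective_def sum_subtractf diff_divide_distrib)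
    then show "\<bar>objective n F (x + h) - objective n F x - client_mean d n g \<bullet> h\<bar> \<le>
        1 / real n * (\<Sum>i=1..n. \<bar>F i (x + h) - F i x - g i \<bullet> h\<bar>)"
      by (simp add: abs_mult divide_right_mono)
  qed
qed

lemma sum_cmult_sum_swap:
  fixes a :: real
  shows "(\<Sum>k\<in>K. (a * (\<Sum>i\<in>I. b i k)) * c k) = a * (\<Sum>i\<in>I. \<Sum>k\<in>K. b i k * c k)"
  by (simp add: sum_distrib_left sum_distrib_right mult.assoc) (rule sum.swap)

text \<open>\<open>G0\<close> is tied to the mean only on \<open>carrier_vec d\<close>, since
  \<open>grad\<close> is controlled only there. The remainder is estimated by coordinates, as
  \<open>client_mean\<close> is defined that way; the resulting factor \<open>d\<close> does not
  disturb a little-o.\<close>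

lemma has_jacobian_mean:
  assumes jac: "\<And>i. i \<in> {1..n} \<Longrightarrow> has_jacobian d (G i) (B i) x"
    and G: "\<And>i y. i \<in> {1..n} \<Longrightarrow> y \<in> carrier_vec d \<Longrightarrow> G i y \<in> carrier_vec d"
    and G0: "\<And>y. y \<in> carrier_vec d \<Longrightarrow> G0 y = client_mean d n (\<lambda>i. G i y)"
    and x: "x \<in> carrier_vec d"
  shows "has_jacobian d G0 (mat d d (\<lambda>(j, k). 1 / real n * (\<Sum>i=1..n. B i $$ (j, k)))) x"
    (is "has_jacobian d G0 ?B x")
  unfolding has_jacobian_iff
proof
  show B0: "?B \<in> carrier_mat d d" by simp
  have B: "B i \<in> carrier_mat d d" if "i \<in> {1..n}" for i
    using jac[OF that] by (simp add: has_jacobian_def)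
  let ?R = "\<lambda>i h. G i (x + h) - G i x - B i *\<^sub>v h"
  have "little_o_norm d (\<lambda>h. \<Sum>j<d. 1 / real n * (\<Sum>i=1..n. vnorm (?R i h)))"
    using jac by (intro little_o_norm_cmult little_o_norm_sum) (auto simp: has_jacobian_iff)
  then show "little_o_norm d (\<lambda>h. vnorm (G0 (x + h) - G0 x - ?B *\<^sub>v h))"
  proof (rule little_o_norm_mono)
    fix h :: "real vec" assume h: "h \<in> carrier_vec d"
    have xh: "x + h \<in> carrier_vec d" using x h by simp
    have R: "?R i h \<in> carrier_vec d" if "i \<in> {1..n}" for i
      using G[OF that x] G[OF that xh] B[OF that] h by auto
    have carr: "G0 (x + h) - G0 x - ?B *\<^sub>v h \<in> carrier_vec d"
      using G0[OF x] G0[OF xh] mult_mat_vec_carrier[OF B0 h]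
      by (intro minus_carrier_vec) (simp_all add: client_mean_def)
    have "\<bar>(G0 (x + h) - G0 x - ?B *\<^sub>v h) $ j\<bar> \<le> 1 / real n * (\<Sum>i=1..n. vnorm (?R i h))"
      if j: "j < d" for j
    proof -
      have "(?B *\<^sub>v h) $ j = (\<Sum>k\<in>{0..<d}. (1 / real n * (\<Sum>i=1..n. B i $$ (j, k))) * h $ k)"
        using j h by (simp add: scalar_prod_def)
      also have "\<dots> = 1 / real n * (\<Sum>i=1..n. \<Sum>k\<in>{0..<d}. B i $$ (j, k) * h $ k)"
        by (rule sum_cmult_sum_swap)
      also have "\<dots> = 1 / real n * (\<Sum>i=1..n. (B i *\<^sub>v h) $ j)"
      proof (rule arg_cong[where f = "\<lambda>s. 1 / real n * s"], rule sum.cong)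
        fix i assume "i \<in> {1..n}"
        from B[OF this] j h
        show "(\<Sum>k = 0..<d. B i $$ (j, k) * h $ k) = (B i *\<^sub>v h) $ j"
          by (simp add: scalar_prod_def)
      qed simp
      finally have Bh: "(?B *\<^sub>v h) $ j = 1 / real n * (\<Sum>i=1..n. (B i *\<^sub>v h) $ j)" .
      have "(G0 (x + h) - G0 x - ?B *\<^sub>v h) $ j = G0 (x + h) $ j - G0 x $ j - (?B *\<^sub>v h) $ j"
        using j G0[OF x] G0[OF xh] h by (simp add: client_mean_def)
      also have "\<dots> = 1 / real n * (\<Sum>i=1..n. G i (x + h) $ j - G i x $ j - (B i *\<^sub>v h) $ j)"
        unfolding Bh using j G0[OF x] G0[OF xh]
        by (simp add: client_mean_def sum_subtractf diff_divide_distrib)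
      also have "\<dots> = 1 / real n * (\<Sum>i=1..n. ?R i h $ j)"
      proof (rule arg_cong[where f = "\<lambda>s. 1 / real n * s"], rule sum.cong)
        fix i assume i: "i \<in> {1..n}"
        from B[OF i] G[OF i x] j h
        show "G i (x + h) $ j - G i x $ j - (B i *\<^sub>v h) $ j = ?R i h $ j"
          by (simp del: index_mult_mat_vec)
      qed simp
      finally have "\<bar>(G0 (x + h) - G0 x - ?B *\<^sub>v h) $ j\<bar> \<le> 1 / real n * (\<Sum>i=1..n. \<bar>?R i h $ j\<bar>)"
        by (simp add: abs_mult divide_right_mono)
      also have "\<dots> \<le> 1 / real n * (\<Sum>i=1..n. vnorm (?R i h))"
        using R j by (intro mult_left_mono sum_mono abs_index_le_vnorm) auto
      finally show ?thesis .
    qed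
    then have "(\<Sum>j<d. \<bar>(G0 (x + h) - G0 x - ?B *\<^sub>v h) $ j\<bar>)
        \<le> (\<Sum>j<d. 1 / real n * (\<Sum>i=1..n. vnorm (?R i h)))"
      by (intro sum_mono) simp
    with vnorm_le_sum_abs[OF carr]
    show "vnorm (G0 (x + h) - G0 x - ?B *\<^sub>v h)
        \<le> (\<Sum>j<d. 1 / real n * (\<Sum>i=1..n. vnorm (?R i h)))" by linarith
  qed
qed

section \<open>The cubic step\<close>

text \<open>The comparison function \<open>c / (m + 1) * t ^ (m + 1)\<close> has derivative
  \<open>c * t ^ m\<close>; subtracting it from \<open>p\<close> and from \<open>- p\<close> gives
  nonincreasing functions. The exponents used are 1 for gradients and 2 for function values.\<close>

lemma abs_increment_le_power:
  fixes p p' :: "real \<Rightarrow> real"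
  assumes deriv: "\<And>t. 0 \<le> t \<Longrightarrow> t \<le> 1 \<Longrightarrow> (p has_real_derivative p' t) (at t)"
    and bound: "\<And>t. 0 \<le> t \<Longrightarrow> t \<le> 1 \<Longrightarrow> \<bar>p' t\<bar> \<le> c * t ^ m"
  shows "\<bar>p 1 - p 0\<bar> \<le> c / (real m + 1)"
proof -
  have mono: "s * p 1 - c / (real m + 1) \<le> s * p 0" if s: "\<bar>s\<bar> = 1" for s :: real
  proof -
    have "s * p 1 - c / (real m + 1) * 1 ^ Suc m \<le> s * p 0 - c / (real m + 1) * 0 ^ Suc m"
    proof (rule DERIV_nonpos_imp_nonincreasing[of 0 1 "\<lambda>t. s * p t - c / (real m + 1) * t ^ Suc m"])
      fix t :: real assume t: "0 \<le> t" "t \<le> 1"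
      have "((\<lambda>t. s * p t - c / (real m + 1) * t ^ Suc m) has_real_derivative
          s * p' t - c * t ^ m) (at t)"
      proof -
        have "c / (real m + 1) * (real (Suc m) * t ^ (Suc m - Suc 0)) = c * t ^ m"
          by (simp add: add.commute[of 1])
        then show ?thesis
          using DERIV_diff[OF DERIV_cmult[OF deriv[OF t], of s]
              DERIV_cmult[OF DERIV_pow[of "Suc m" t], of "c / (real m + 1)"]]
          by (simp only:)
      qed
      moreover have "s * p' t \<le> c * t ^ m"
        using bound[OF t] abs_ge_self[of "s * p' t"] s by (simp add: abs_mult)
      ultimately show "\<exists>y. ((\<lambda>t. s * p t - c / (real m + 1) * t ^ Suc m) has_real_derivative y) (at t)
          \<and> y \<le> 0" by (intro exI[of _ "s * p' t - c * t ^ m"]) simp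
    qed simp
    then show ?thesis by simp
  qed
  from mono[of 1] mono[of "-1"] show ?thesis by simp
qed

text \<open>Stands in for the limit \<open>t\<close> to 0 in the perturbation arguments that
  follow.\<close>

lemma nonpos_if_le_small_multiples:
  fixes q c :: real
  assumes "\<And>t. 0 < t \<Longrightarrow> t \<le> 1 \<Longrightarrow> q \<le> c * t"
  shows "q \<le> 0"
proof (rule field_le_epsilon)
  fix e :: real assume e: "0 < e"
  define t where "t = min 1 (e / (\<bar>c\<bar> + 1))"
  have t: "0 < t" "t \<le> 1" "t \<le> e / (\<bar>c\<bar> + 1)" using e by (auto simp: t_def)
  have "q \<le> (\<bar>c\<bar> + 1) * t"
    using assms[OF t(1,2)] t(1) mult_right_mono[of c "\<bar>c\<bar> + 1" t] by linarith
  also have "\<dots> \<le> e" using t(3) by (simp add: field_simps)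
  finally show "q \<le> 0 + e" by simp
qed

lemma vnorm_add_sq:
  assumes "u \<in> carrier_vec d" "v \<in> carrier_vec d"
  shows "(vnorm (u + v))\<^sup>2 = (vnorm u)\<^sup>2 + 2 * (u \<bullet> v) + (vnorm v)\<^sup>2"
  using assms comm_scalar_prod[OF assms]
  by (simp add: vnorm_sq add_scalar_prod_distrib[where n=d] scalar_prod_add_distrib[where n=d])

lemma abs_vnorm_add_diff_le:
  assumes u: "u \<in> carrier_vec d" and v: "v \<in> carrier_vec d"
  shows "\<bar>vnorm (u + v) - vnorm u\<bar> \<le> vnorm v"
proof -
  have "u + v + (-1) \<cdot>\<^sub>v v = u" using u v by (auto intro!: eq_vecI)
  then have "vnorm u \<le> vnorm (u + v) + vnorm v"
    using vnorm_triangle[of "u + v" d "(-1) \<cdot>\<^sub>v v"] u v by (simp add: vnorm_smult)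
  with vnorm_triangle[OF u v] show ?thesis by linarith
qed

text \<open>\<open>key\<close> is the exact growth of the model from \<open>h = y - x\<close> to
  \<open>h + w\<close>: a linear part \<open>G\<close>, a quadratic part \<open>q\<close>, and a
  remainder governed by the change of norm. Perturbing along \<open>- t * G\<close> forces
  \<open>G = 0\<close>. For the curvature bound the remainder has to be made zero or negligible,
  which takes two cases according to whether \<open>w\<close> is orthogonal to
  \<open>h\<close>.\<close>

lemma cubic_step_optimality:
  assumes step: "cubic_step d M g H x y" and M: "0 < M"
    and H: "H \<in> carrier_mat d d" and sym: "symmetric_form d H"
    and g: "g \<in> carrier_vec d" and x: "x \<in> carrier_vec d"
  defines "r \<equiv> vnorm (y - x)"
  shows "\<And>w. w \<in> carrier_vec d \<Longrightarrow>
      (g + H *\<^sub>v (y - x)) \<bullet> w = - (M / 2) * r * ((y - x) \<bullet> w)"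
    and "\<And>w. w \<in> carrier_vec d \<Longrightarrow> - (M / 2) * r * (vnorm w)\<^sup>2 \<le> (H *\<^sub>v w) \<bullet> w"
proof -
  define h where "h = y - x"
  have y: "y \<in> carrier_vec d" using step by (simp add: cubic_step_def is_arg_min_def)
  have h: "h \<in> carrier_vec d" using x y by (simp add: h_def)
  have Hv: "H *\<^sub>v v \<in> carrier_vec d" if "v \<in> carrier_vec d" for v
    using H that by simp
  have r: "r = vnorm h" "0 \<le> r" by (simp_all add: r_def h_def)
  define q where "q w = (H *\<^sub>v w) \<bullet> w + M / 2 * r * (vnorm w)\<^sup>2" for w
  define G where "G = g + H *\<^sub>v h + (M / 2 * r) \<cdot>\<^sub>v h"
  have G: "G \<in> carrier_vec d" using g h Hv by (simp add: G_def)
  have key: "0 \<le> G \<bullet> w + q w / 2 + M / 6 * ((vnorm (h + w) - r)\<^sup>2 * (vnorm (h + w) + r / 2))"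
    if w: "w \<in> carrier_vec d" for w
  proof -
    define s where "s = vnorm (h + w)"
    have "x + (h + w) - x = h + w" using x h w by (auto intro!: eq_vecI)
    moreover have "cubic_model M g H x y \<le> cubic_model M g H x (x + (h + w))"
    proof -
      have "x + (h + w) \<in> carrier_vec d" using x h w by simp
      with step show ?thesis unfolding cubic_step_def is_arg_min_def by (meson not_less)
    qed
    ultimately have "0 \<le> g \<bullet> (h + w) - g \<bullet> h + ((H *\<^sub>v (h + w)) \<bullet> (h + w) - (H *\<^sub>v h) \<bullet> h) / 2
        + M / 6 * (s ^ 3 - r ^ 3)"
      unfolding cubic_model_def h_def[symmetric] r(1) s_def by (simp add: field_simps)
    also have "g \<bullet> (h + w) - g \<bullet> h = g \<bullet> w"
      using g h w by (simp add: scalar_prod_add_distrib[where n=d])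
    also have "(H *\<^sub>v (h + w)) \<bullet> (h + w) - (H *\<^sub>v h) \<bullet> h = 2 * ((H *\<^sub>v h) \<bullet> w) + (H *\<^sub>v w) \<bullet> w"
      using sym h w Hv[OF h] Hv[OF w] H
      by (simp add: symmetric_form_def mult_add_distrib_mat_vec[where nr=d and nc=d]
          scalar_prod_add_distrib[where n=d] add_scalar_prod_distrib[where n=d])
    \<comment> \<open>Splitting off a multiple of \<open>s^2 - r^2\<close> isolates what is
      polynomial in \<open>w\<close>; the rest is nonnegative and vanishes when
      \<open>s = r\<close>.\<close>
    also have "s ^ 3 - r ^ 3 = 3 / 2 * r * (s\<^sup>2 - r\<^sup>2) + (s - r)\<^sup>2 * (s + r / 2)"
      by (simp add: power2_eq_square power3_eq_cube field_simps)
    also have "s\<^sup>2 - r\<^sup>2 = 2 * (h \<bullet> w) + (vnorm w)\<^sup>2"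
      using vnorm_add_sq[OF h w] by (simp add: s_def r(1))
    finally have "0 \<le> g \<bullet> w + (2 * ((H *\<^sub>v h) \<bullet> w) + (H *\<^sub>v w) \<bullet> w) / 2 +
        M / 6 * (3 / 2 * r * (2 * (h \<bullet> w) + (vnorm w)\<^sup>2) + (s - r)\<^sup>2 * (s + r / 2))" .
    moreover have "G \<bullet> w = g \<bullet> w + (H *\<^sub>v h) \<bullet> w + M / 2 * r * (h \<bullet> w)"
      using g h w Hv[OF h] by (simp add: G_def add_scalar_prod_distrib[where n=d])
    ultimately show ?thesis by (simp add: q_def s_def algebra_simps add_divide_distrib)
  qed
  have "(vnorm G)\<^sup>2 \<le> 0"
  proof (rule nonpos_if_le_small_multiples)
    fix t :: real assume t: "0 < t" "t \<le> 1"
    let ?w = "(- t) \<cdot>\<^sub>v G"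
    let ?s = "vnorm (h + ?w)"
    have w: "?w \<in> carrier_vec d" using G by simp
    have sr: "\<bar>?s - r\<bar> \<le> t * vnorm G"
      using abs_vnorm_add_diff_le[OF h w] t by (simp add: r(1) vnorm_smult)
    have "t * vnorm G \<le> vnorm G" using t by (simp add: mult_left_le_one_le)
    then have "?s + r / 2 \<le> vnorm G + 2 * r" using sr r(2) by linarith
    moreover have "(?s - r)\<^sup>2 \<le> (t * vnorm G)\<^sup>2"
      using power_mono[OF sr, of 2] by simp
    ultimately have "(?s - r)\<^sup>2 * (?s + r / 2) \<le> (t * vnorm G)\<^sup>2 * (vnorm G + 2 * r)"
      using r(2) by (intro mult_mono) auto
    then have "M / 6 * ((?s - r)\<^sup>2 * (?s + r / 2)) \<le> M / 6 * ((t * vnorm G)\<^sup>2 * (vnorm G + 2 * r))"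
      using M by (intro mult_left_mono) auto
    moreover have "G \<bullet> ?w = - (t * (vnorm G)\<^sup>2)" using G by (simp add: vnorm_sq)
    moreover have "q ?w = t\<^sup>2 * q G"
    proof -
      have "H *\<^sub>v ?w = (- t) \<cdot>\<^sub>v (H *\<^sub>v G)" using H G by (intro mult_mat_vec) auto
      then show ?thesis
        using G Hv[OF G] by (simp add: q_def vnorm_smult power2_eq_square algebra_simps)
    qed
    ultimately have "t * (vnorm G)\<^sup>2 \<le>
        t\<^sup>2 * q G / 2 + M / 6 * ((t * vnorm G)\<^sup>2 * (vnorm G + 2 * r))"
      using key[OF w] by linarith
    also have "\<dots> = t * ((q G / 2 + M / 6 * ((vnorm G)\<^sup>2 * (vnorm G + 2 * r))) * t)"
      by (simp add: power2_eq_square algebra_simps)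
    finally have "t * (vnorm G)\<^sup>2 \<le> \<dots>" .
    with t(1) show "(vnorm G)\<^sup>2 \<le> (q G / 2 + M / 6 * ((vnorm G)\<^sup>2 * (vnorm G + 2 * r))) * t"
      by (simp only: mult_le_cancel_left_pos)
  qed
  then have "G = 0\<^sub>v d" using vnorm_eq_0_iff[OF G] by simp
  then have G0: "G \<bullet> w = 0" if "w \<in> carrier_vec d" for w using that by simp
  show "(g + H *\<^sub>v (y - x)) \<bullet> w = - (M / 2) * r * ((y - x) \<bullet> w)" if w: "w \<in> carrier_vec d" for w
    using G0[OF w] g h w Hv[OF h]
    by (simp add: G_def h_def[symmetric] add_scalar_prod_distrib[where n=d])
  show "- (M / 2) * r * (vnorm w)\<^sup>2 \<le> (H *\<^sub>v w) \<bullet> w" if w: "w \<in> carrier_vec d" for w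
  proof -
    have scale: "q (t \<cdot>\<^sub>v w) = t\<^sup>2 * q w" for t
    proof -
      have "H *\<^sub>v (t \<cdot>\<^sub>v w) = t \<cdot>\<^sub>v (H *\<^sub>v w)" using H w by (intro mult_mat_vec) auto
      then show ?thesis
        using w Hv[OF w] by (simp add: q_def vnorm_smult power2_eq_square algebra_simps)
    qed
    have sq: "(vnorm (h + t \<cdot>\<^sub>v w))\<^sup>2 = r\<^sup>2 + 2 * t * (h \<bullet> w) + t\<^sup>2 * (vnorm w)\<^sup>2" for t
      using vnorm_add_sq[of h d "t \<cdot>\<^sub>v w"] h w by (simp add: r(1) vnorm_smult power_mult_distrib)
    have "0 \<le> q w"
    proof (cases "h \<bullet> w = 0")
      case False
      then have W: "vnorm w \<noteq> 0" using w h vnorm_eq_0_iff[OF w] by auto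
      \<comment> \<open>The line from \<open>h\<close> in direction \<open>w\<close> meets the
        sphere of radius \<open>r\<close> a second time at this \<open>t\<close>. There the
        remainder in \<open>key\<close> is exactly zero. This compares \<open>y\<close> with a point
        that need not be close, so global minimality is used.\<close>
      define t where "t = - 2 * (h \<bullet> w) / (vnorm w)\<^sup>2"
      have t: "t \<noteq> 0" using False W by (simp add: t_def)
      have "2 * t * (h \<bullet> w) + t\<^sup>2 * (vnorm w)\<^sup>2 = t * (2 * (h \<bullet> w) + t * (vnorm w)\<^sup>2)"
        by (simp add: power2_eq_square algebra_simps)
      also have "\<dots> = 0" using W by (simp add: t_def)
      finally have "(vnorm (h + t \<cdot>\<^sub>v w))\<^sup>2 = r\<^sup>2" using sq[of t] by simp
      then have "vnorm (h + t \<cdot>\<^sub>v w) = r" using r(2) by (simp add: power2_eq_iff_nonneg)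
      then have "0 \<le> t\<^sup>2 * q w" using key[of "t \<cdot>\<^sub>v w"] G0[of "t \<cdot>\<^sub>v w"] w scale[of t] by simp
      with t show ?thesis by (simp add: zero_le_mult_iff)
    next
      case True
      have "- q w \<le> 0"
      proof (rule nonpos_if_le_small_multiples)
        fix t :: real assume t: "0 < t" "t \<le> 1"
        define s where "s = vnorm (h + t \<cdot>\<^sub>v w)"
        have s2: "s\<^sup>2 - r\<^sup>2 = t\<^sup>2 * (vnorm w)\<^sup>2" using sq[of t] True by (simp add: s_def)
        have st: "s - r \<le> t * vnorm w"
          using abs_vnorm_add_diff_le[of h d "t \<cdot>\<^sub>v w"] h w t by (simp add: s_def r(1) vnorm_smult)
        \<comment> \<open>Enlarging \<open>r / 2\<close> to \<open>r\<close> completes the factor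
          \<open>s^2 - r^2\<close>, which is \<open>t^2 * |w|^2\<close> as \<open>w\<close> is
          orthogonal to \<open>h\<close>. So the remainder is of order \<open>t^3\<close>, against
          \<open>t^2\<close> for \<open>q\<close>.\<close>
        have "(s - r)\<^sup>2 * (s + r / 2) \<le> (s - r)\<^sup>2 * (s + r)"
          using r(2) by (intro mult_left_mono) auto
        also have "\<dots> = (s - r) * (s\<^sup>2 - r\<^sup>2)" by (simp add: power2_eq_square algebra_simps)
        also have "\<dots> \<le> (t * vnorm w) * (s\<^sup>2 - r\<^sup>2)"
          using st s2 by (intro mult_right_mono) auto
        finally have "M / 6 * ((s - r)\<^sup>2 * (s + r / 2)) \<le> M / 6 * ((t * vnorm w) * (t\<^sup>2 * (vnorm w)\<^sup>2))"
          using M unfolding s2 by (intro mult_left_mono) auto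
        then have "t\<^sup>2 * (- q w) \<le> t\<^sup>2 * (M / 3 * (vnorm w) ^ 3 * t)"
          using key[of "t \<cdot>\<^sub>v w"] G0[of "t \<cdot>\<^sub>v w"] w scale[of t]
          by (simp add: s_def[symmetric] power2_eq_square power3_eq_cube algebra_simps)
        then show "- q w \<le> M / 3 * (vnorm w) ^ 3 * t"
          using t(1) by (simp only: mult_le_cancel_left_pos zero_less_power)
      qed
      then show ?thesis by simp
    qed
    then show ?thesis by (simp add: q_def)
  qed
qed

text \<open>Meant for the mean objective. The Lipschitz condition is phrased on vectors, as the
  estimates use it, so that the \<open>Sup\<close> in \<open>spectral_norm\<close> is dealt with
  once, when the locale is instantiated.\<close>

locale lipschitz_hessian_function =
  fixes d :: nat and f :: "real vec \<Rightarrow> real" and G :: "real vec \<Rightarrow> real vec"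
    and A :: "real vec \<Rightarrow> real mat" and L :: real
  assumes gradient: "x \<in> carrier_vec d \<Longrightarrow> has_gradient d f (G x) x"
    and jacobian: "x \<in> carrier_vec d \<Longrightarrow> has_jacobian d G (A x) x"
    and lipschitz: "x \<in> carrier_vec d \<Longrightarrow> y \<in> carrier_vec d \<Longrightarrow> v \<in> carrier_vec d \<Longrightarrow>
      vnorm ((A x - A y) *\<^sub>v v) \<le> L * vnorm (x - y) * vnorm v"
    and L_nonneg: "0 \<le> L"
begin

lemma gradient_carrier: "x \<in> carrier_vec d \<Longrightarrow> G x \<in> carrier_vec d"
  using gradient by (simp add: has_gradient_def)

lemma hessian_carrier: "x \<in> carrier_vec d \<Longrightarrow> A x \<in> carrier_mat d d"
  using jacobian by (simp add: has_jacobian_def)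

lemma hessian_mult_carrier:
  "x \<in> carrier_vec d \<Longrightarrow> v \<in> carrier_vec d \<Longrightarrow> A x *\<^sub>v v \<in> carrier_vec d"
  using hessian_carrier by (meson mult_mat_vec_carrier)

lemma hessian_diff_form_le:
  assumes "x \<in> carrier_vec d" "y \<in> carrier_vec d" "v \<in> carrier_vec d" "w \<in> carrier_vec d"
  shows "\<bar>(A x *\<^sub>v v) \<bullet> w - (A y *\<^sub>v v) \<bullet> w\<bar> \<le> L * vnorm (x - y) * vnorm v * vnorm w"
proof -
  have carr: "A x *\<^sub>v v \<in> carrier_vec d" "A y *\<^sub>v v \<in> carrier_vec d"
    using assms by (simp_all add: hessian_mult_carrier)
  have "(A x *\<^sub>v v) \<bullet> w - (A y *\<^sub>v v) \<bullet> w = ((A x - A y) *\<^sub>v v) \<bullet> w"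
    using assms carr hessian_carrier[of x] hessian_carrier[of y]
    by (simp add: minus_mult_distrib_mat_vec[where nr=d and nc=d] minus_scalar_prod_distrib[where n=d])
  also have "\<bar>\<dots>\<bar> \<le> vnorm ((A x - A y) *\<^sub>v v) * vnorm w"
    using assms mult_mat_vec_carrier[OF minus_carrier_mat[OF hessian_carrier], of y v "A x"]
    by (intro abs_scalar_prod_le_vnorm[where d=d]) auto
  also have "\<dots> \<le> L * vnorm (x - y) * vnorm v * vnorm w"
    using assms by (intro mult_right_mono lipschitz) auto
  finally show ?thesis .
qed

lemma gradient_taylor:
  assumes x: "x \<in> carrier_vec d" and h: "h \<in> carrier_vec d" and w: "w \<in> carrier_vec d"
  shows "\<bar>G (x + h) \<bullet> w - G x \<bullet> w - (A x *\<^sub>v h) \<bullet> w\<bar> \<le> L / 2 * (vnorm h)\<^sup>2 * vnorm w"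
proof -
  let ?p = "\<lambda>t. G (x + t \<cdot>\<^sub>v h) \<bullet> w - t * ((A x *\<^sub>v h) \<bullet> w)"
  let ?p' = "\<lambda>t. (A (x + t \<cdot>\<^sub>v h) *\<^sub>v h) \<bullet> w - (A x *\<^sub>v h) \<bullet> w"
  have xt: "x + t \<cdot>\<^sub>v h \<in> carrier_vec d" for t using x h by simp
  have "\<bar>?p 1 - ?p 0\<bar> \<le> (L * (vnorm h)\<^sup>2 * vnorm w) / (real 1 + 1)"
  proof (rule abs_increment_le_power[where p' = ?p'])
    fix t :: real assume t: "0 \<le> t" "t \<le> 1"
    show "(?p has_real_derivative ?p' t) (at t)"
      using has_jacobian_imp_has_real_derivative[OF jacobian[OF xt] gradient_carrier x h w]
      by (auto intro!: derivative_eq_intros)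
    have "x + t \<cdot>\<^sub>v h - x = t \<cdot>\<^sub>v h" using x h by (auto intro!: eq_vecI)
    then show "\<bar>?p' t\<bar> \<le> L * (vnorm h)\<^sup>2 * vnorm w * t ^ 1"
      using hessian_diff_form_le[OF xt x h w, of t] t
      by (simp add: vnorm_smult power2_eq_square mult_ac)
  qed
  moreover have "x + 1 \<cdot>\<^sub>v h = x + h" "x + 0 \<cdot>\<^sub>v h = x" using x h by (auto intro!: eq_vecI)
  ultimately show ?thesis by (simp add: algebra_simps)
qed

text \<open>The derivative of \<open>?p\<close> is the gradient remainder for the increment
  \<open>t * h\<close>, of size \<open>t^2\<close> by \<open>gradient_taylor\<close>; integrating
  turns \<open>L / 2\<close> into \<open>L / 6\<close>.\<close>

lemma function_taylor:
  assumes x: "x \<in> carrier_vec d" and h: "h \<in> carrier_vec d"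
  shows "\<bar>f (x + h) - f x - G x \<bullet> h - (A x *\<^sub>v h) \<bullet> h / 2\<bar> \<le> L / 6 * vnorm h ^ 3"
proof -
  let ?p = "\<lambda>t. f (x + t \<cdot>\<^sub>v h) - t * (G x \<bullet> h) - t\<^sup>2 * ((A x *\<^sub>v h) \<bullet> h / 2)"
  let ?p' = "\<lambda>t. G (x + t \<cdot>\<^sub>v h) \<bullet> h - G x \<bullet> h - t * ((A x *\<^sub>v h) \<bullet> h)"
  have xt: "x + t \<cdot>\<^sub>v h \<in> carrier_vec d" for t using x h by simp
  have "\<bar>?p 1 - ?p 0\<bar> \<le> (L / 2 * vnorm h ^ 3) / (real 2 + 1)"
  proof (rule abs_increment_le_power[where p' = ?p'])
    fix t :: real assume t: "0 \<le> t" "t \<le> 1"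
    show "(?p has_real_derivative ?p' t) (at t)"
      using has_gradient_imp_has_real_derivative[OF gradient[OF xt] x h]
      by (auto intro!: derivative_eq_intros)
    have "A x *\<^sub>v (t \<cdot>\<^sub>v h) = t \<cdot>\<^sub>v (A x *\<^sub>v h)"
      using hessian_carrier[OF x] h by (intro mult_mat_vec) auto
    then show "\<bar>?p' t\<bar> \<le> L / 2 * vnorm h ^ 3 * t ^ 2"
      using gradient_taylor[OF x _ h, of "t \<cdot>\<^sub>v h"] t h hessian_mult_carrier[OF x h]
      by (simp add: vnorm_smult power2_eq_square power3_eq_cube mult_ac)
  qed
  moreover have "x + 1 \<cdot>\<^sub>v h = x + h" "x + 0 \<cdot>\<^sub>v h = x" using x h by (auto intro!: eq_vecI)
  ultimately show ?thesis by (simp add: algebra_simps)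
qed

text \<open>\<open>f (x + a + b)\<close> is expanded in two ways: at once from \<open>x\<close>, and
  by way of \<open>x + a\<close>. The quadratic terms differ by half the skew part. The errors are
  three cubic Taylor remainders (\<open>L / 6\<close> each), the gradient remainder and the change
  of Hessian along \<open>b\<close> (\<open>L / 2\<close> each), in total
  \<open>3 / 2 * L * N ^ 3\<close>.\<close>

lemma hessian_skew_part_small:
  assumes x: "x \<in> carrier_vec d" and a: "a \<in> carrier_vec d" and b: "b \<in> carrier_vec d"
    and N: "vnorm a + vnorm b \<le> N"
  shows "\<bar>(A x *\<^sub>v a) \<bullet> b - (A x *\<^sub>v b) \<bullet> a\<bar> \<le> 3 * L * N ^ 3"
proof -
  have xa: "x + a \<in> carrier_vec d" and ab: "a + b \<in> carrier_vec d" using x a b by simp_all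
  have bounds: "0 \<le> N" "vnorm a \<le> N" "vnorm b \<le> N" "vnorm (a + b) \<le> N"
    using N vnorm_triangle[OF a b] vnorm_nonneg[of a] vnorm_nonneg[of b] by linarith+
  have cube: "L * vnorm v ^ 3 \<le> L * N ^ 3" if "vnorm v \<le> N" for v
    using that L_nonneg by (intro mult_left_mono power_mono) auto
  have assoc: "x + (a + b) = x + a + b" using x a b by (auto intro!: eq_vecI)
  have diff: "x + a - x = a" using x a by (auto intro!: eq_vecI)
  have "L * ((vnorm a)\<^sup>2 * vnorm b) \<le> L * (N\<^sup>2 * N)"
    using bounds L_nonneg by (intro mult_left_mono mult_mono power_mono) auto
  moreover have "L * (vnorm a * (vnorm b * vnorm b)) \<le> L * (N * (N * N))"
    using bounds L_nonneg by (intro mult_left_mono mult_mono) auto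
  ultimately have mixed: "L * (vnorm a)\<^sup>2 * vnorm b \<le> L * N ^ 3"
    "L * vnorm a * vnorm b * vnorm b \<le> L * N ^ 3"
    by (simp_all add: power2_eq_square power3_eq_cube mult_ac)
  have "G x \<bullet> (a + b) = G x \<bullet> a + G x \<bullet> b"
    using gradient_carrier[OF x] a b by (simp add: scalar_prod_add_distrib[where n=d])
  moreover have "(A x *\<^sub>v (a + b)) \<bullet> (a + b) =
      (A x *\<^sub>v a) \<bullet> a + (A x *\<^sub>v a) \<bullet> b + (A x *\<^sub>v b) \<bullet> a + (A x *\<^sub>v b) \<bullet> b"
    using a b hessian_carrier[OF x] hessian_mult_carrier[OF x a] hessian_mult_carrier[OF x b]
    by (simp add: mult_add_distrib_mat_vec[where nr=d and nc=d]
        scalar_prod_add_distrib[where n=d] add_scalar_prod_distrib[where n=d])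
  ultimately show ?thesis
    using function_taylor[OF x ab] function_taylor[OF xa b] function_taylor[OF x a]
      gradient_taylor[OF x a b] hessian_diff_form_le[OF xa x b b]
      cube[OF bounds(2)] cube[OF bounds(3)] cube[OF bounds(4)] mixed
    unfolding assoc diff by linarith
qed

text \<open>Under scaling of both vectors by \<open>t\<close> the skew part is of order
  \<open>t^2\<close> but its bound of order \<open>t^3\<close>.\<close>

lemma hessian_symmetric:
  assumes x: "x \<in> carrier_vec d"
  shows "symmetric_form d (A x)"
  unfolding symmetric_form_def
proof (intro ballI)
  fix u v :: "real vec" assume u: "u \<in> carrier_vec d" and v: "v \<in> carrier_vec d"
  let ?s = "(A x *\<^sub>v u) \<bullet> v - (A x *\<^sub>v v) \<bullet> u"
  let ?N = "vnorm u + vnorm v"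
  have "\<bar>?s\<bar> \<le> 0"
  proof (rule nonpos_if_le_small_multiples)
    fix t :: real assume t: "0 < t" "t \<le> 1"
    have scale: "A x *\<^sub>v (t \<cdot>\<^sub>v w) = t \<cdot>\<^sub>v (A x *\<^sub>v w)" if "w \<in> carrier_vec d" for w
      using hessian_carrier[OF x] that by (intro mult_mat_vec) auto
    have "\<bar>(A x *\<^sub>v (t \<cdot>\<^sub>v u)) \<bullet> (t \<cdot>\<^sub>v v) - (A x *\<^sub>v (t \<cdot>\<^sub>v v)) \<bullet> (t \<cdot>\<^sub>v u)\<bar> \<le> 3 * L * (t * ?N) ^ 3"
      using x u v t by (intro hessian_skew_part_small) (auto simp: vnorm_smult distrib_left)
    moreover have "(A x *\<^sub>v (t \<cdot>\<^sub>v u)) \<bullet> (t \<cdot>\<^sub>v v) - (A x *\<^sub>v (t \<cdot>\<^sub>v v)) \<bullet> (t \<cdot>\<^sub>v u) = t\<^sup>2 * ?s"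
      using u v hessian_mult_carrier[OF x u] hessian_mult_carrier[OF x v]
      by (simp add: scale power2_eq_square algebra_simps)
    ultimately have "t\<^sup>2 * \<bar>?s\<bar> \<le> t\<^sup>2 * (3 * L * ?N ^ 3 * t)"
      by (simp add: abs_mult power_mult_distrib power2_eq_square power3_eq_cube mult_ac)
    then show "\<bar>?s\<bar> \<le> 3 * L * ?N ^ 3 * t"
      using t(1) by (simp only: mult_le_cancel_left_pos zero_less_power)
  qed
  then show "(A x *\<^sub>v u) \<bullet> v = (A x *\<^sub>v v) \<bullet> u" by simp
qed

section \<open>One cubic step from \<open>x\<close> with the Hessian taken at an earlier point
  \<open>z\<close>\<close>

context
  fixes M :: real and x y z :: "real vec" and r D :: real
  assumes M: "0 < M" and x: "x \<in> carrier_vec d" and z: "z \<in> carrier_vec d"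
    and step: "cubic_step d M (G x) (A z) x y"
  defines "r \<equiv> vnorm (y - x)" and "D \<equiv> vnorm (x - z)"
begin

lemma next_iterate: "y \<in> carrier_vec d" "y - x \<in> carrier_vec d" "x + (y - x) = y"
proof -
  show y: "y \<in> carrier_vec d" using step by (simp add: cubic_step_def is_arg_min_def)
  then show "y - x \<in> carrier_vec d" using x by simp
  show "x + (y - x) = y" using x y by (auto intro!: eq_vecI)
qed

lemmas optimality = cubic_step_optimality[OF step M hessian_carrier[OF z] hessian_symmetric[OF z]
    gradient_carrier[OF x] x, folded r_def]

lemma cubic_step_first_order:
  assumes w: "w \<in> carrier_vec d"
  shows "G x \<bullet> w + (A z *\<^sub>v (y - x)) \<bullet> w = - (M / 2) * r * ((y - x) \<bullet> w)"
  using optimality(1)[OF w] w gradient_carrier[OF x] hessian_mult_carrier[OF z next_iterate(2)]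
  by (simp add: add_scalar_prod_distrib[where n=d])

text \<open>Both optimality conditions are tested with the step \<open>h\<close> itself:
  \<open>g . h + (H h) . h / 2 = - M / 2 * r^3 - (H h) . h / 2\<close>, which is at most
  \<open>- M / 4 * r^3\<close>. The two losses are the Taylor remainder and the exchange of
  \<open>A x\<close> for \<open>A z\<close>.\<close>

lemma cubic_step_descent: "M / 4 * r ^ 3 - L / 6 * r ^ 3 - L / 2 * D * r\<^sup>2 \<le> f x - f y"
proof -
  note h = next_iterate(2)
  have "f y - f x - G x \<bullet> (y - x) - (A x *\<^sub>v (y - x)) \<bullet> (y - x) / 2 \<le> L / 6 * r ^ 3"
    using abs_le_D1[OF function_taylor[OF x h]] by (simp add: next_iterate(3) r_def)
  moreover have "(A x *\<^sub>v (y - x)) \<bullet> (y - x) - (A z *\<^sub>v (y - x)) \<bullet> (y - x) \<le> L * D * r\<^sup>2"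
    using hessian_diff_form_le[OF x z h h]
    by (simp add: D_def r_def power2_eq_square mult.assoc)
  moreover have "G x \<bullet> (y - x) + (A z *\<^sub>v (y - x)) \<bullet> (y - x) = - (M / 2) * r ^ 3"
    using cubic_step_first_order[OF h] vnorm_sq[of "y - x"]
    by (simp add: r_def power2_eq_square power3_eq_cube)
  moreover have "- (M / 2) * r ^ 3 \<le> (A z *\<^sub>v (y - x)) \<bullet> (y - x)"
    using optimality(2)[OF h] by (simp add: r_def power2_eq_square power3_eq_cube)
  ultimately show ?thesis by (simp add: field_simps)
qed

text \<open>The new gradient is paired with itself. Its square splits into the Taylor remainder, the
  staleness error and the regularization term, each at most a multiple of its norm, which is then
  cancelled.\<close>

lemma cubic_step_gradient_le: "vnorm (G y) \<le> (M + L) / 2 * r\<^sup>2 + L * D * r"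
proof -
  note h = next_iterate(2)
  have w: "G y \<in> carrier_vec d" using gradient_carrier next_iterate(1) by blast
  have "(vnorm (G y))\<^sup>2 = (G y \<bullet> G y - G x \<bullet> G y - (A x *\<^sub>v (y - x)) \<bullet> G y)
      + ((A x *\<^sub>v (y - x)) \<bullet> G y - (A z *\<^sub>v (y - x)) \<bullet> G y) - M / 2 * r * ((y - x) \<bullet> G y)"
    using cubic_step_first_order[OF w] by (simp add: vnorm_sq)
  moreover have "G y \<bullet> G y - G x \<bullet> G y - (A x *\<^sub>v (y - x)) \<bullet> G y \<le> L / 2 * r\<^sup>2 * vnorm (G y)"
    using abs_le_D1[OF gradient_taylor[OF x h w]] by (simp add: next_iterate(3) r_def)
  moreover have "(A x *\<^sub>v (y - x)) \<bullet> G y - (A z *\<^sub>v (y - x)) \<bullet> G y \<le> L * D * r * vnorm (G y)"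
    using hessian_diff_form_le[OF x z h w] by (simp add: D_def r_def)
  moreover have "- (M / 2 * r * ((y - x) \<bullet> G y)) \<le> M / 2 * r * (r * vnorm (G y))"
  proof -
    have "- ((y - x) \<bullet> G y) \<le> r * vnorm (G y)"
      using abs_scalar_prod_le_vnorm[OF h w] by (simp add: r_def)
    then have "M / 2 * r * (- ((y - x) \<bullet> G y)) \<le> M / 2 * r * (r * vnorm (G y))"
      using M by (intro mult_left_mono) (auto simp: r_def)
    then show ?thesis by simp
  qed
  ultimately have "vnorm (G y) * vnorm (G y) \<le> vnorm (G y) * ((M + L) / 2 * r\<^sup>2 + L * D * r)"
    by (simp add: power2_eq_square field_simps)
  moreover have "0 \<le> (M + L) / 2 * r\<^sup>2 + L * D * r"
    using M L_nonneg by (simp add: r_def D_def)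
  ultimately show ?thesis
    by (cases "vnorm (G y) = 0") (auto simp: mult_le_cancel_left_pos order_less_le)
qed

text \<open>The curvature bound holds at \<open>z\<close>; passing to \<open>y\<close>, at distance
  at most \<open>r + D\<close>, costs \<open>L * (r + D)\<close>.\<close>

lemma cubic_step_lambda_min_ge:
  assumes d: "0 < d"
  shows "- ((M / 2 + L) * r + L * D) \<le> lambda_min (A y)"
proof (rule lambda_min_ge[OF _ d])
  note y = next_iterate(1)
  show "A y \<in> carrier_mat d d" "symmetric_form d (A y)"
    using y by (simp_all add: hessian_carrier hessian_symmetric)
  fix v :: "real vec" assume v: "v \<in> carrier_vec d"
  have "y - x + (x - z) = y - z" using x y z by (auto intro!: eq_vecI)
  then have "vnorm (y - z) \<le> r + D"
    using vnorm_triangle[of "y - x" d "x - z"] x y z by (simp add: r_def D_def)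
  then have "L * vnorm (y - z) * (vnorm v)\<^sup>2 \<le> L * (r + D) * (vnorm v)\<^sup>2"
    using L_nonneg by (intro mult_right_mono mult_left_mono) auto
  moreover have "(A z *\<^sub>v v) \<bullet> v - (A y *\<^sub>v v) \<bullet> v \<le> L * vnorm (y - z) * (vnorm v)\<^sup>2"
    using hessian_diff_form_le[OF y z v v] by (simp add: power2_eq_square mult.assoc)
  moreover have "- (M / 2) * r * (vnorm v)\<^sup>2 \<le> (A z *\<^sub>v v) \<bullet> v"
    using optimality(2)[OF v] .
  ultimately show "- ((M / 2 + L) * r + L * D) * (vnorm v)\<^sup>2 \<le> (A y *\<^sub>v v) \<bullet> v"
    by (simp add: algebra_simps)
qed

end

end

section \<open>Snapshot Hessians of C2EDEN\<close>

lemma twice_differentiable_has_gradient: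
  assumes "twice_differentiable d f" and x: "x \<in> carrier_vec d"
  shows "has_gradient d f (grad d f x) x"
proof -
  obtain g where "has_gradient d f g x"
    using assms by (auto simp: twice_differentiable_def)
  with grad_eqI[OF this x] show ?thesis by simp
qed

text \<open>\<open>diff\<close> is required at all points, because uniqueness of the Jacobian
  presupposes a field with values in \<open>carrier_vec d\<close>.\<close>

lemma hess_eqI:
  assumes diff: "\<And>y. y \<in> carrier_vec d \<Longrightarrow> has_gradient d f (grad d f y) y"
    and jac: "has_jacobian d (grad d f) A x" and x: "x \<in> carrier_vec d"
  shows "hess d f x = A"
proof -
  have "grad d f y \<in> carrier_vec d" if "y \<in> carrier_vec d" for y
    using diff[OF that] by (simp add: has_gradient_def)
  then have "B = A" if "has_jacobian d (grad d f) B x" for B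
    using has_jacobian_unique[OF that jac] x by blast
  with jac show ?thesis unfolding hess_def by (rule the_equality)
qed

lemma twice_differentiable_has_jacobian:
  assumes diff: "twice_differentiable d f" and x: "x \<in> carrier_vec d"
  shows "has_jacobian d (grad d f) (hess d f x) x"
proof -
  obtain A where "has_jacobian d (grad d f) A x"
    using assms by (auto simp: twice_differentiable_def)
  with hess_eqI[OF twice_differentiable_has_gradient[OF diff] this x] show ?thesis by simp
qed

section \<open>Gradient and Hessian of the mean objective\<close>

context
  fixes d n :: nat and F :: "nat \<Rightarrow> real vec \<Rightarrow> real" and L :: real
  assumes problem: "problem_instance d n F L"
begin

lemma problem_dims: "0 < d" "0 < n" "0 < L"
  using problem by (simp_all add: problem_instance_def)

lemma client_twice_differentiable: "i \<in> {1..n} \<Longrightarrow> twice_differentiable d (F i)"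
  using problem by (simp add: problem_instance_def)

lemma objective_has_gradient:
  assumes x: "x \<in> carrier_vec d"
  shows "has_gradient d (objective n F) (client_mean d n (\<lambda>i. grad d (F i) x)) x"
  using x by (intro has_gradient_mean twice_differentiable_has_gradient client_twice_differentiable)

lemma grad_objective:
  assumes "x \<in> carrier_vec d"
  shows "grad d (objective n F) x = client_mean d n (\<lambda>i. grad d (F i) x)"
  using assms by (intro grad_eqI objective_has_gradient)

lemma objective_has_jacobian:
  assumes x: "x \<in> carrier_vec d"
  shows "has_jacobian d (grad d (objective n F))
    (mat d d (\<lambda>(j, k). 1 / real n * (\<Sum>i=1..n. hess d (F i) x $$ (j, k)))) x"
proof (rule has_jacobian_mean[where G = "\<lambda>i. grad d (F i)"])
  show "has_jacobian d (grad d (F i)) (hess d (F i) x) x" if "i \<in> {1..n}" for i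
    using that x by (intro twice_differentiable_has_jacobian client_twice_differentiable)
  show "grad d (F i) y \<in> carrier_vec d" if "i \<in> {1..n}" "y \<in> carrier_vec d" for i y
    using twice_differentiable_has_gradient[OF client_twice_differentiable[OF that(1)] that(2)]
    by (simp add: has_gradient_def)
qed (use grad_objective x in auto)

lemma hess_objective:
  assumes x: "x \<in> carrier_vec d"
  shows "hess d (objective n F) x =
    mat d d (\<lambda>(j, k). 1 / real n * (\<Sum>i=1..n. hess d (F i) x $$ (j, k)))"
  using x objective_has_gradient
  by (intro hess_eqI objective_has_jacobian) (simp_all add: grad_objective)

lemma hess_objective_carrier:
  "x \<in> carrier_vec d \<Longrightarrow> hess d (objective n F) x \<in> carrier_mat d d"
  by (simp add: hess_objective)

text \<open>Allows the averages of client columns to be read as columns of one Hessian.\<close>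

lemma mean_hess_col_eq_col:
  assumes x: "x \<in> carrier_vec d" and c: "c < d"
  shows "mean_hess_col d n F x c = col (hess d (objective n F) x) c"
proof -
  have "(hess d (F i) x *\<^sub>v unit_vec d c) $ j = hess d (F i) x $$ (j, c)"
    if "i \<in> {1..n}" "j < d" for i j
  proof -
    have "hess d (F i) x \<in> carrier_mat d d"
      using twice_differentiable_has_jacobian[OF client_twice_differentiable[OF that(1)] x]
      by (simp add: has_jacobian_def)
    with c that(2) show ?thesis by simp
  qed
  with c show ?thesis
    by (auto simp: mean_hess_col_def client_mean_def hess_objective[OF x] intro!: eq_vecI sum.cong)
qed

lemma objective_lipschitz_hessian_function:
  "lipschitz_hessian_function d (objective n F) (grad d (objective n F)) (hess d (objective n F)) L"
proof
  show "has_gradient d (objective n F) (grad d (objective n F) x) x" if "x \<in> carrier_vec d" for x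
    using objective_has_gradient[OF that] grad_objective[OF that] by simp
  show "has_jacobian d (grad d (objective n F)) (hess d (objective n F) x) x"
    if "x \<in> carrier_vec d" for x
    using objective_has_jacobian[OF that] hess_objective[OF that] by simp
  show "0 \<le> L" using problem_dims by simp
  fix x y v :: "real vec"
  assume x: "x \<in> carrier_vec d" and y: "y \<in> carrier_vec d" and v: "v \<in> carrier_vec d"
  let ?B = "hess d (objective n F) x - hess d (objective n F) y"
  have "?B \<in> carrier_mat d d" using hess_objective_carrier[OF y] by (rule minus_carrier_mat)
  then have "vnorm (?B *\<^sub>v v) \<le> spectral_norm d ?B * vnorm v"
    using v by (rule vnorm_mult_mat_vec_le)
  also have "\<dots> \<le> L * vnorm (x - y) * vnorm v"
    using problem x y
    by (intro mult_right_mono) (auto simp: problem_instance_def lipschitz_hessian_def)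
  finally show "vnorm (?B *\<^sub>v v) \<le> L * vnorm (x - y) * vnorm v" .
qed

end

text \<open>Index of the iterate whose Hessian is used in iteration \<open>k\<close>. It is \<open>\<tau>(k;d)\<close>, except that
  \<open>\<tau>(k;d) = 0\<close> becomes \<open>d\<close>: the iterates start at index \<open>d\<close>, and \<open>x\<^sub>d = x\<^sub>0\<close>.\<close>

definition snapshot :: "nat \<Rightarrow> nat \<Rightarrow> nat" where
  "snapshot d k = d * max 1 (k div d - 1)"

text \<open>Filling \<open>Hp\<close> takes one round of \<open>d\<close> iterations and the result
  serves for one more, hence an age below \<open>2 * d\<close>.\<close>

lemma snapshot_bounds:
  assumes "0 < d" "d \<le> k"
  shows "d \<le> snapshot d k" "snapshot d k \<le> k" "k < snapshot d k + 2 * d"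
proof -
  have q: "1 \<le> k div d" using assms by (simp add: Suc_le_eq div_greater_zero_iff)
  have k: "d * (k div d) \<le> k" "k < d * (k div d) + d"
    using assms mult_div_mod_eq[of d k] mod_less_divisor[of d k] by linarith+
  show "d \<le> snapshot d k" by (simp add: snapshot_def)
  have "d * max 1 (k div d - 1) \<le> d * (k div d)" using q by (intro mult_left_mono) auto
  with k show "snapshot d k \<le> k" unfolding snapshot_def by linarith
  have "d * (k div d) \<le> d * (max 1 (k div d - 1) + 1)" by (intro mult_left_mono) auto
  with k(2) show "k < snapshot d k + 2 * d" by (simp add: snapshot_def)
qed

text \<open>The columns of \<open>H\<^sup>+\<close> already overwritten in the current round belong to the last
  snapshot point, the others still to the one before.\<close>

lemma c2eden_hessians:
  fixes xt :: "nat \<Rightarrow> real vec" and H Hp :: "nat \<Rightarrow> real mat" and B :: "real vec \<Rightarrow> real mat"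
  assumes d: "0 < d"
    and B: "\<And>k. d \<le> k \<Longrightarrow> B (x k) \<in> carrier_mat d d"
    and Hp0: "Hp d = B (x d)"
    and xt: "\<And>k. d \<le> k \<Longrightarrow> xt k = (if k mod d = 0 then x k else xt (k - 1))"
    and H: "\<And>k. d \<le> k \<Longrightarrow> H k = (if k mod d = 0 then Hp k else H (k - 1))"
    and Hp: "\<And>k j. d \<le> k \<Longrightarrow> xt k = x j \<Longrightarrow> d \<le> j \<Longrightarrow>
      Hp (Suc k) = replace_col (Hp k) (col (B (x j)) (k mod d)) (k mod d)"
    and k: "d \<le> k"
  shows "H k = B (x (snapshot d k)) \<and> xt k = x (d * (k div d)) \<and> Hp k \<in> carrier_mat d d \<and>
    (\<forall>c<d. col (Hp k) c =
      col (B (if c < k mod d then x (d * (k div d)) else x (snapshot d k))) c)"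
  using k
proof (induction k rule: dec_induct)
  case base
  \<comment> \<open>At \<open>k = d\<close> both points in the case distinction on columns are
    \<open>x d\<close>: the first round rewrites the columns it already has.\<close>
  have "snapshot d d = d" using d by (simp add: snapshot_def)
  with d B[of d] Hp0 xt[of d] H[of d] show ?case by simp
next
  case (step k)
  define j where "j = d * (k div d)"
  define m where "m = k mod d"
  have q: "1 \<le> k div d" using d step.hyps by (simp add: Suc_le_eq div_greater_zero_iff)
  then have dj: "d \<le> j" by (simp add: j_def)
  have IH: "H k = B (x (snapshot d k))" "xt k = x j" "Hp k \<in> carrier_mat d d"
    "\<And>c. c < d \<Longrightarrow> col (Hp k) c = col (B (if c < m then x j else x (snapshot d k))) c"
    using step.IH by (simp_all add: j_def m_def)
  have Hp': "Hp (Suc k) = replace_col (Hp k) (col (B (x j)) m) m"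
    using Hp[of k j] step.hyps IH(2) dj by (simp add: m_def)
  then have carr: "Hp (Suc k) \<in> carrier_mat d d"
    using IH(3) by (simp add: replace_col_def)
  have col: "col (Hp (Suc k)) c = col (B (if c < Suc m then x j else x (snapshot d k))) c"
    if c: "c < d" for c
  proof (cases "c = m")
    case True
    with c IH(3) B[OF dj] show ?thesis
      by (auto simp: Hp' replace_col_def intro!: eq_vecI)
  next
    case False
    then have "col (Hp (Suc k)) c = col (Hp k) c"
      using c IH(3) by (auto simp: Hp' replace_col_def intro!: eq_vecI)
    with False IH(4)[OF c] show ?thesis by auto
  qed
  show ?case
  proof (cases "Suc m = d")
    case False
    then have "Suc m < d" using mod_less_divisor[OF d, of k] unfolding m_def by linarith
    then have mod: "Suc k mod d = Suc m" "Suc k div d = k div d"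
      by (simp_all add: m_def mod_Suc div_Suc)
    then have "snapshot d (Suc k) = snapshot d k" by (simp add: snapshot_def)
    with mod IH carr col xt[of "Suc k"] H[of "Suc k"] step.hyps show ?thesis
      by (simp add: j_def)
  next
    case True
    then have mod: "Suc k mod d = 0" "Suc k div d = Suc (k div d)"
      by (simp_all add: m_def mod_Suc div_Suc)
    then have snap: "snapshot d (Suc k) = j" using q by (simp add: snapshot_def j_def)
    have Suck: "Suc k = d * (Suc k div d)" using mod mult_div_mod_eq[of d "Suc k"] by simp
    \<comment> \<open>The round is complete, so every column now stems from \<open>x j\<close>, and
      this matrix becomes the new \<open>H\<close>.\<close>
    have col': "col (Hp (Suc k)) c = col (B (x j)) c" if "c < d" for c
      using col[OF that] that True by simp
    have "Hp (Suc k) = B (x j)"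
    proof (rule eq_matI)
      fix i c assume "i < dim_row (B (x j))" "c < dim_col (B (x j))"
      then have ic: "i < d" "c < d" using B[OF dj] by auto
      then have "col (Hp (Suc k)) c $ i = col (B (x j)) c $ i" by (simp add: col')
      with ic carr B[OF dj] show "Hp (Suc k) $$ (i, c) = B (x j) $$ (i, c)" by simp
    qed (use carr B[OF dj] in auto)
    with mod snap carr col' xt[of "Suc k"] H[of "Suc k"] step.hyps Suck show ?thesis
      by simp
  qed
qed

text \<open>Eliminates the internal state: from here on only the recursion with the stale Hessian is
  used.\<close>

lemma c2eden_iterates:
  assumes problem: "problem_instance d n F L" and x0: "x0 \<in> carrier_vec d"
    and run: "c2eden d n F M x0 x"
  shows "x d = x0"
    and "d \<le> k \<Longrightarrow> x k \<in> carrier_vec d"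
    and "d \<le> k \<Longrightarrow> cubic_step d M (grad d (objective n F) (x k))
      (hess d (objective n F) (x (snapshot d k))) (x k) (x (Suc k))"
proof -
  obtain xt H Hp where Hp0: "Hp d = mat_of_cols d (map (mean_hess_col d n F x0) [0..<d])"
    and xd: "x d = x0"
    and xt: "\<And>k. d \<le> k \<Longrightarrow> xt k = (if k mod d = 0 then x k else xt (k - 1))"
    and H: "\<And>k. d \<le> k \<Longrightarrow> H k = (if k mod d = 0 then Hp k else H (k - 1))"
    and step: "\<And>k. d \<le> k \<Longrightarrow>
      cubic_step d M (client_mean d n (\<lambda>i. grad d (F i) (x k))) (H k) (x k) (x (Suc k))"
    and Hp: "\<And>k. d \<le> k \<Longrightarrow>
      Hp (Suc k) = replace_col (Hp k) (mean_hess_col d n F (xt k) (k mod d)) (k mod d)"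
    using run unfolding c2eden_def by blast
  have d: "0 < d" using problem by (rule problem_dims)
  have carr: "x k \<in> carrier_vec d" if "d \<le> k" for k
    using that
  proof (induction k rule: dec_induct)
    case base
    show ?case using xd x0 by simp
  next
    case (step k)
    with \<open>\<And>k. d \<le> k \<Longrightarrow> cubic_step d M _ (H k) (x k) (x (Suc k))\<close>[of k] show ?case
      by (simp add: cubic_step_def is_arg_min_def)
  qed
  then show "x k \<in> carrier_vec d" if "d \<le> k" using that .
  show "x d = x0" by (rule xd)
  have "Hp d = hess d (objective n F) (x d)"
    unfolding Hp0 xd
    using hess_objective_carrier[OF problem x0] mean_hess_col_eq_col[OF problem x0]
    by (auto simp: mat_of_cols_index intro!: eq_matI)
  then have "H k = hess d (objective n F) (x (snapshot d k))" if "d \<le> k" for k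
    using c2eden_hessians[where B = "hess d (objective n F)" and x = x, OF d _ _ xt H _ that]
      hess_objective_carrier[OF problem carr] Hp mean_hess_col_eq_col[OF problem carr] d
    by simp
  with step[of k] show "cubic_step d M (grad d (objective n F) (x k))
      (hess d (objective n F) (x (snapshot d k))) (x k) (x (Suc k))" if "d \<le> k"
    using that by (simp add: grad_objective[OF problem carr])
qed

section \<open>Convergence\<close>

text \<open>A power mean inequality in which \<open>m\<close> need only bound the number of terms,
  so that windows of different lengths share one constant. The excess is harmless because the number
  of terms enters the sum of the tangents with a negative sign.\<close>

lemma sum_cube_le:
  fixes r :: "'a \<Rightarrow> real"
  assumes fin: "finite J" and card: "real (card J) \<le> m" and m: "0 < m"
    and r: "\<And>j. j \<in> J \<Longrightarrow> 0 \<le> r j"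
  shows "(\<Sum>j\<in>J. r j) ^ 3 \<le> m\<^sup>2 * (\<Sum>j\<in>J. r j ^ 3)"
proof -
  define S where "S = (\<Sum>j\<in>J. r j)"
  define a where "a = S / m"
  have a: "0 \<le> a" "S = a * m" using m r by (auto simp: a_def S_def intro!: sum_nonneg divide_nonneg_pos)
  \<comment> \<open>the tangent to the cube at the mean value \<open>a\<close>\<close>
  have "3 * a\<^sup>2 * r j - 2 * a ^ 3 \<le> r j ^ 3" if "j \<in> J" for j
  proof -
    have "0 \<le> (r j - a)\<^sup>2 * (r j + 2 * a)" using r[OF that] a(1) by simp
    then show ?thesis by (simp add: power2_eq_square power3_eq_cube algebra_simps)
  qed
  then have "(\<Sum>j\<in>J. 3 * a\<^sup>2 * r j - 2 * a ^ 3) \<le> (\<Sum>j\<in>J. r j ^ 3)" by (rule sum_mono)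
  moreover have "(\<Sum>j\<in>J. 3 * a\<^sup>2 * r j - 2 * a ^ 3) = 3 * a\<^sup>2 * S - real (card J) * (2 * a ^ 3)"
    by (simp add: sum_subtractf S_def sum_distrib_left)
  moreover have "real (card J) * (2 * a ^ 3) \<le> m * (2 * a ^ 3)"
    using card a(1) by (intro mult_right_mono) auto
  ultimately have "m * a ^ 3 \<le> (\<Sum>j\<in>J. r j ^ 3)"
    by (simp add: a(2) power2_eq_square power3_eq_cube algebra_simps)
  then have "m\<^sup>2 * (m * a ^ 3) \<le> m\<^sup>2 * (\<Sum>j\<in>J. r j ^ 3)" by (rule mult_left_mono) simp
  moreover have "S ^ 3 = m\<^sup>2 * (m * a ^ 3)"
    by (simp add: a(2) power2_eq_square power3_eq_cube mult_ac)
  ultimately show ?thesis by (simp add: S_def)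
qed

lemma vnorm_diff_le_path:
  assumes carr: "\<And>k. l \<le> k \<Longrightarrow> x k \<in> carrier_vec d" and "l \<le> k"
  shows "vnorm (x k - x l) \<le> (\<Sum>j=l..<k. vnorm (x (Suc j) - x j))"
  using assms(2)
proof (induction k rule: dec_induct)
  case base
  have "vnorm (x l - x l) = 0" using carr[of l] vnorm_eq_0_iff[of "0\<^sub>v d" d] by simp
  then show ?case by simp
next
  case (step k)
  have c: "x k \<in> carrier_vec d" "x (Suc k) \<in> carrier_vec d" "x l \<in> carrier_vec d"
    using step carr by simp_all
  then have "x (Suc k) - x k + (x k - x l) = x (Suc k) - x l" by (auto intro!: eq_vecI)
  with vnorm_triangle[of "x (Suc k) - x k" d "x k - x l"] c step show ?case by simp
qed

text \<open>Double counting: if \<open>j\<close> lies in the window of \<open>k\<close>, then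
  \<open>k\<close> lies in \<open>{j..<j + 2 * d}\<close>. Writing this as an indicator makes the
  index range rectangular, so the sums can be swapped.\<close>

lemma sum_windows_le:
  fixes a :: "nat \<Rightarrow> real"
  assumes d: "0 < d" and a: "\<And>j. 0 \<le> a j"
  shows "(\<Sum>k=d..<K. \<Sum>j=snapshot d k..<k. a j) \<le> 2 * real d * (\<Sum>j=d..<K. a j)"
proof -
  have "(\<Sum>j=snapshot d k..<k. a j) \<le> (\<Sum>j=d..<K. if k \<in> {j..<j + 2 * d} then a j else 0)"
    if k: "k \<in> {d..<K}" for k
  proof -
    have "(\<Sum>j=snapshot d k..<k. a j)
        = (\<Sum>j=snapshot d k..<k. if k \<in> {j..<j + 2 * d} then a j else 0)"
      using snapshot_bounds[of d k] d k by (intro sum.cong) auto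
    also have "\<dots> \<le> (\<Sum>j=d..<K. if k \<in> {j..<j + 2 * d} then a j else 0)"
      using snapshot_bounds[of d k] d k a by (intro sum_mono2) auto
    finally show ?thesis .
  qed
  then have "(\<Sum>k=d..<K. \<Sum>j=snapshot d k..<k. a j)
      \<le> (\<Sum>k=d..<K. \<Sum>j=d..<K. if k \<in> {j..<j + 2 * d} then a j else 0)"
    by (rule sum_mono)
  also have "\<dots> = (\<Sum>j=d..<K. \<Sum>k=d..<K. if k \<in> {j..<j + 2 * d} then a j else 0)"
    by (rule sum.swap)
  also have "\<dots> \<le> (\<Sum>j=d..<K. 2 * real d * a j)"
  proof (rule sum_mono)
    fix j
    have "(\<Sum>k=d..<K. if k \<in> {j..<j + 2 * d} then a j else 0)
        = real (card ({d..<K} \<inter> {j..<j + 2 * d})) * a j"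
      by (subst sum.inter_restrict[symmetric]) simp_all
    also have "\<dots> \<le> real (2 * d) * a j"
      using card_mono[of "{j..<j + 2 * d}" "{d..<K} \<inter> {j..<j + 2 * d}"] a
      by (intro mult_right_mono) auto
    finally show "(\<Sum>k=d..<K. if k \<in> {j..<j + 2 * d} then a j else 0) \<le> 2 * real d * a j"
      by simp
  qed
  finally show ?thesis by (simp add: sum_distrib_left)
qed

section \<open>Numerical constants of a single iteration\<close>

lemma powr_three_halves: "0 \<le> a \<Longrightarrow> a powr (3 / 2) = sqrt a ^ 3"
  for a :: real
  by (cases "a = 0") (simp_all add: powr_half_sqrt[symmetric] powr_power)

text \<open>Here \<open>s\<close> stands for the staleness \<open>D / d\<close>, so that \<open>L * D = M * s / 12\<close>.\<close>

lemma progress_measure_le_step: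
  fixes M L r s e l :: real
  assumes M: "0 < M" and L: "0 \<le> L" "L \<le> M / 12" and r: "0 \<le> r" and s: "0 \<le> s"
    and l: "- ((M / 2 + L) * r + M * s / 12) \<le> l"
    and e: "0 \<le> e" "e \<le> (M + L) / 2 * r\<^sup>2 + M * s / 12 * r"
  shows "max (- (1 / (648 * M\<^sup>2)) * l ^ 3) (1 / (72 * sqrt (2 * M)) * e powr (3 / 2))
    \<le> M / 100 * (r ^ 3 + s ^ 3)"
proof (rule max.boundedI)
  \<comment> \<open>The hypotheses collapse to \<open>- l <= M * m\<close> (from 7/12 + 1/12) and
    \<open>e <= M * m^2\<close> (from 13/24 + 1/12), so both parts of the maximum become multiples
    of \<open>M * m^3\<close>.\<close>
  define m where "m = max r s"
  have m: "0 \<le> m" "r \<le> m" "s \<le> m" using r by (auto simp: m_def)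
  have "m ^ 3 \<le> r ^ 3 + s ^ 3" using r s by (auto simp: m_def max_def)
  then have cube: "M * m ^ 3 \<le> M * (r ^ 3 + s ^ 3)" using M by simp
  have "(M / 2 + L) * r \<le> (7 / 12 * M) * m"
    using M L m r by (intro mult_mono) auto
  moreover have "M * s / 12 \<le> M * m / 12" using M m by simp
  ultimately have "- l \<le> M * m" using l M m(1) mult_nonneg_nonneg[of M m] by linarith
  \<comment> \<open>Odd powers are monotone on all reals, which covers positive \<open>l\<close> as
    well.\<close>
  then have "(- l) ^ 3 \<le> (M * m) ^ 3" by (intro power_mono_odd) simp
  then have "1 / (648 * M\<^sup>2) * (- l) ^ 3 \<le> 1 / (648 * M\<^sup>2) * (M * m) ^ 3"
    by (intro mult_left_mono) auto
  also have "\<dots> = M * m ^ 3 / 648"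
    using M by (simp add: power2_eq_square power3_eq_cube field_simps)
  also have "\<dots> \<le> M * m ^ 3 / 100" using M m(1) by (intro divide_left_mono) auto
  also have "\<dots> \<le> M / 100 * (r ^ 3 + s ^ 3)" using cube by simp
  finally show "- (1 / (648 * M\<^sup>2)) * l ^ 3 \<le> M / 100 * (r ^ 3 + s ^ 3)" by simp
  have "r\<^sup>2 \<le> m\<^sup>2" using r m by (intro power_mono)
  then have "(M + L) / 2 * r\<^sup>2 \<le> (13 / 24 * M) * m\<^sup>2"
    using M L by (intro mult_mono) auto
  moreover have "M * s / 12 * r \<le> M * m / 12 * m"
    using M m r s by (intro mult_mono divide_right_mono mult_left_mono) auto
  moreover have "0 \<le> M * m\<^sup>2" using M by simp
  ultimately have "e \<le> M * m\<^sup>2" using e(2) by (simp add: power2_eq_square field_simps)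
  then have "sqrt e \<le> sqrt M * m"
    using m(1) by (metis real_sqrt_le_iff real_sqrt_mult real_sqrt_abs abs_of_nonneg)
  then have "sqrt e ^ 3 \<le> (sqrt M * m) ^ 3" using e(1) by (intro power_mono) auto
  then have "1 / (72 * sqrt (2 * M)) * e powr (3 / 2) \<le> 1 / (72 * sqrt (2 * M)) * (sqrt M * m) ^ 3"
    unfolding powr_three_halves[OF e(1)] using M by (intro mult_left_mono) auto
  also have "\<dots> = M * m ^ 3 / (72 * sqrt 2)"
    using M by (simp add: real_sqrt_mult power3_eq_cube field_simps)
  also have "\<dots> \<le> M * m ^ 3 / 100"
  proof (rule divide_left_mono)
    \<comment> \<open>The 1/100 originates here: \<open>72 * sqrt 2\<close> is about 101.8, and the
      eigenvalue part needs only 1/648.\<close>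
    have "(14 / 10 :: real) \<le> sqrt 2" by (rule real_le_rsqrt) (simp add: power2_eq_square)
    then show "100 \<le> 72 * sqrt (2 :: real)" by linarith
  qed (use M m in auto)
  also have "\<dots> \<le> M / 100 * (r ^ 3 + s ^ 3)" using cube by simp
  finally show "1 / (72 * sqrt (2 * M)) * e powr (3 / 2) \<le> M / 100 * (r ^ 3 + s ^ 3)" .
qed

text \<open>Budget in units of \<open>M\<close>, with \<open>3 * s * r^2 <= 2 * r^3 + s^3\<close>
  for the mixed term: \<open>r^3\<close> has 1/4 - 1/72 - 2/72 = 5/24 available and 1/100 + 49/250 =
  0.206 is claimed; \<open>s^3\<close> costs 1/72, within 49/2000 - 1/100 = 0.0145. The ratio 8 of
  49/250 to 49/2000 is the factor in \<open>sum_staleness_le\<close>.\<close>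

lemma step_decrease_ge:
  fixes M L r s :: real
  assumes M: "0 < M" and L: "0 \<le> L" "L \<le> M / 12" and r: "0 \<le> r" and s: "0 \<le> s"
  shows "M / 100 * (r ^ 3 + s ^ 3) + M * (49 / 250 * r ^ 3 - 49 / 2000 * s ^ 3)
    \<le> M / 4 * r ^ 3 - L / 6 * r ^ 3 - M * s / 24 * r\<^sup>2"
proof -
  have "L / 6 * r ^ 3 \<le> M / 72 * r ^ 3" using L r by (intro mult_right_mono) auto
  moreover have "M * (3 * s * r\<^sup>2) \<le> M * (2 * r ^ 3 + s ^ 3)"
  proof (rule mult_left_mono)
    have "0 \<le> (r - s)\<^sup>2 * (2 * r + s)" using r s by simp
    then show "3 * s * r\<^sup>2 \<le> 2 * r ^ 3 + s ^ 3"
      by (simp add: power2_eq_square power3_eq_cube algebra_simps)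
  qed (use M in simp)
  moreover have "0 \<le> M * r ^ 3" "0 \<le> M * s ^ 3" using M r s by simp_all
  ultimately show ?thesis by (simp add: field_simps)
qed

section \<open>Summation over the iterations\<close>

context
  fixes d n :: nat and F :: "nat \<Rightarrow> real vec \<Rightarrow> real" and L :: real
    and x0 :: "real vec" and x :: "nat \<Rightarrow> real vec"
  assumes problem: "problem_instance d n F L" and x0: "x0 \<in> carrier_vec d"
    and run: "c2eden d n F (12 * real d * L) x0 x"
begin

lemma one_iteration:
  assumes k: "d \<le> k"
  defines "M \<equiv> 12 * real d * L"
    and "r \<equiv> vnorm (x (Suc k) - x k)" and "s \<equiv> vnorm (x k - x (snapshot d k)) / real d"
  shows "progress_measure d M (objective n F) (x (Suc k))
      + M * (49 / 250 * r ^ 3 - 49 / 2000 * s ^ 3)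
    \<le> objective n F (x k) - objective n F (x (Suc k))"
proof -
  interpret f: lipschitz_hessian_function d "objective n F" "grad d (objective n F)"
    "hess d (objective n F)" L
    using problem by (rule objective_lipschitz_hessian_function)
  note it = c2eden_iterates[OF problem x0 run]
  have pos: "0 < d" "0 < L" using problem_dims[OF problem] by auto
  have M: "0 < M" using pos by (simp add: M_def)
  have L: "0 \<le> L" "L \<le> M / 12" using pos by (simp_all add: M_def)
  have rs: "0 \<le> r" "0 \<le> s" by (simp_all add: r_def s_def)
  have snap: "d \<le> snapshot d k" using snapshot_bounds pos k by blast
  have LD: "L * vnorm (x k - x (snapshot d k)) = M * s / 12"
    using pos by (simp add: M_def s_def)
  note step = M it(2)[OF k] it(2)[OF snap] it(3)[OF k, folded M_def]
  have "M / 4 * r ^ 3 - L / 6 * r ^ 3 - M * s / 24 * r\<^sup>2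
      \<le> objective n F (x k) - objective n F (x (Suc k))"
    using f.cubic_step_descent[OF step] LD by (simp add: r_def field_simps)
  moreover have "progress_measure d M (objective n F) (x (Suc k)) \<le> M / 100 * (r ^ 3 + s ^ 3)"
    unfolding progress_measure_def
    using f.cubic_step_lambda_min_ge[OF step pos(1)] f.cubic_step_gradient_le[OF step]
    by (intro progress_measure_le_step[OF M L rs]) (simp_all add: LD r_def)
  moreover note step_decrease_ge[OF M L rs]
  ultimately show ?thesis by linarith
qed

text \<open>The 8 is \<open>(2 * d)^2\<close> from \<open>sum_cube_le\<close> times
  \<open>2 * d\<close> from \<open>sum_windows_le\<close>, divided by \<open>d^3\<close>.\<close>

lemma sum_staleness_le:
  "(\<Sum>k=d..<K. (vnorm (x k - x (snapshot d k)) / real d) ^ 3)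
    \<le> 8 * (\<Sum>j=d..<K. vnorm (x (Suc j) - x j) ^ 3)"
proof -
  have d: "0 < d" using problem_dims[OF problem] by auto
  let ?r = "\<lambda>j. vnorm (x (Suc j) - x j)"
  have "(vnorm (x k - x (snapshot d k)) / real d) ^ 3 \<le> 4 / real d * (\<Sum>j=snapshot d k..<k. ?r j ^ 3)"
    if k: "d \<le> k" for k
  proof -
    note snap = snapshot_bounds[OF d k]
    have "vnorm (x k - x (snapshot d k)) ^ 3 \<le> (\<Sum>j=snapshot d k..<k. ?r j) ^ 3"
      using snap c2eden_iterates(2)[OF problem x0 run]
      by (intro power_mono vnorm_diff_le_path[where d=d]) auto
    also have "\<dots> \<le> (2 * real d)\<^sup>2 * (\<Sum>j=snapshot d k..<k. ?r j ^ 3)"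
      using snap d by (intro sum_cube_le) auto
    finally have "vnorm (x k - x (snapshot d k)) ^ 3 / real d ^ 3
        \<le> (2 * real d)\<^sup>2 * (\<Sum>j=snapshot d k..<k. ?r j ^ 3) / real d ^ 3"
      by (rule divide_right_mono) simp
    with d show ?thesis
      by (simp add: power_divide power2_eq_square power3_eq_cube)
  qed
  then have "(\<Sum>k=d..<K. (vnorm (x k - x (snapshot d k)) / real d) ^ 3)
      \<le> (\<Sum>k=d..<K. 4 / real d * (\<Sum>j=snapshot d k..<k. ?r j ^ 3))"
    by (intro sum_mono) simp
  also have "\<dots> = 4 / real d * (\<Sum>k=d..<K. \<Sum>j=snapshot d k..<k. ?r j ^ 3)"
    by (simp add: sum_distrib_left)
  also have "\<dots> \<le> 4 / real d * (2 * real d * (\<Sum>j=d..<K. ?r j ^ 3))"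
    using d by (intro mult_left_mono sum_windows_le) auto
  finally show ?thesis using d by simp
qed

lemma min_progress_measure_le:
  assumes K: "d < K"
  shows "(MIN i\<in>{d<..K}. progress_measure d (12 * real d * L) (objective n F) (x i))
    \<le> (objective n F x0 - f_star d (objective n F)) / real (K - d)"
proof -
  let ?f = "objective n F" and ?M = "12 * real d * L"
  let ?p = "\<lambda>i. progress_measure d ?M ?f (x i)"
  let ?r = "\<lambda>k. vnorm (x (Suc k) - x k)" and ?s = "\<lambda>k. vnorm (x k - x (snapshot d k)) / real d"
  note it = c2eden_iterates[OF problem x0 run]
  have M: "0 < ?M" using problem_dims[OF problem] by simp
  have "(\<Sum>k=d..<K. ?p (Suc k) + ?M * (49 / 250 * ?r k ^ 3 - 49 / 2000 * ?s k ^ 3))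
      \<le> (\<Sum>k=d..<K. ?f (x k) - ?f (x (Suc k)))"
    using one_iteration by (intro sum_mono) auto
  moreover have "(\<Sum>k=d..<K. ?f (x k) - ?f (x (Suc k))) = ?f (x d) - ?f (x K)"
    using sum_Suc_diff'[of d K "\<lambda>k. - ?f (x k)"] K by simp
  moreover have "0 \<le> ?M * (\<Sum>k=d..<K. 49 / 250 * ?r k ^ 3 - 49 / 2000 * ?s k ^ 3)"
  proof (rule mult_nonneg_nonneg)
    have "(\<Sum>k=d..<K. 49 / 250 * ?r k ^ 3 - 49 / 2000 * ?s k ^ 3)
        = 49 / 250 * (\<Sum>k=d..<K. ?r k ^ 3) - 49 / 2000 * (\<Sum>k=d..<K. ?s k ^ 3)"
      by (simp only: sum_subtractf sum_distrib_left)
    with sum_staleness_le[of K]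
    show "0 \<le> (\<Sum>k=d..<K. 49 / 250 * ?r k ^ 3 - 49 / 2000 * ?s k ^ 3)" by linarith
  qed (use M in simp)
  ultimately have "(\<Sum>k=d..<K. ?p (Suc k)) \<le> ?f x0 - ?f (x K)"
    by (simp add: sum.distrib sum_distrib_left it(1))
  moreover have "f_star d ?f \<le> ?f (x K)"
    unfolding f_star_def using problem it(2)[of K] K
    by (intro cINF_lower) (auto simp: problem_instance_def)
  \<comment> \<open>An iteration controls the measure at the point it produces, hence the shift of
    the range, which leaves out \<open>x d\<close>.\<close>
  moreover have "(\<Sum>k=d..<K. ?p (Suc k)) = (\<Sum>i\<in>{d<..K}. ?p i)"
    using sum.shift_bounds_Suc_ivl[of ?p d K]
    by (simp add: atLeastSucLessThan_greaterThanLessThan atLeastLessThanSuc_atLeastAtMost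
        atLeastSucAtMost_greaterThanAtMost)
  moreover have "of_nat (card {d<..K}) * (MIN i\<in>{d<..K}. ?p i) \<le> (\<Sum>i\<in>{d<..K}. ?p i)"
    by (intro sum_bounded_below) auto
  ultimately have "real (K - d) * (MIN i\<in>{d<..K}. ?p i) \<le> ?f x0 - f_star d ?f" by simp
  with K show ?thesis by (simp add: field_simps)
qed

end

text \<open>The constant is \<open>93312 = 648 * 12\<^sup>2\<close>, from the eigenvalue part of \<open>\<gamma>\<close> with \<open>M = 12 q\<^sup>2\<close>.\<close>

lemma small_progress_measure_imp:
  fixes q e :: real
  assumes q: "0 < q" and e: "0 < e" and M: "M = 12 * q\<^sup>2"
    and p: "progress_measure d M f x \<le> sqrt e ^ 3 / (93312 * q)"
  shows "vnorm (grad d f x) \<le> e" and "- (q * sqrt e) \<le> lambda_min (hess d f x)"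
proof -
  let ?g = "vnorm (grad d f x)" and ?l = "lambda_min (hess d f x)"
  have "sqrt (2 * M) = sqrt 24 * q" using q by (simp add: M real_sqrt_mult)
  \<comment> \<open>A crude bound is enough: \<open>72 * 5\<close> is far below 93312.\<close>
  moreover have "sqrt 24 \<le> (5 :: real)" by (rule real_le_lsqrt) simp_all
  ultimately have root: "sqrt (2 * M) \<le> 5 * q" using q by simp
  have pos: "0 < sqrt (2 * M)" using q by (simp add: M)
  have "1 / (72 * sqrt (2 * M)) * sqrt ?g ^ 3 \<le> sqrt e ^ 3 / (93312 * q)"
    using p by (simp add: progress_measure_def powr_three_halves)
  then have "sqrt ?g ^ 3 \<le> sqrt e ^ 3 / (93312 * q) * (72 * sqrt (2 * M))"
    using pos by (simp add: field_simps)
  also have "\<dots> \<le> sqrt e ^ 3 / (93312 * q) * (72 * (5 * q))"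
    using root q e by (intro mult_left_mono) auto
  also have "\<dots> \<le> sqrt e ^ 3" using q e by simp
  finally have "sqrt ?g \<le> sqrt e" using e by (subst (asm) power_mono_iff) simp_all
  then show "?g \<le> e" by simp
  have "- (1 / (648 * M\<^sup>2)) * ?l ^ 3 \<le> sqrt e ^ 3 / (93312 * q)"
    using p by (simp add: progress_measure_def)
  then have "- (?l ^ 3) / (93312 * q ^ 4) \<le> sqrt e ^ 3 / (93312 * q)"
    by (simp add: M power_mult_distrib flip: power_mult)
  then have "- (?l ^ 3) \<le> (q * sqrt e) ^ 3"
    using q by (simp add: field_simps power_mult_distrib eval_nat_numeral)
  then have "(- ?l) ^ 3 \<le> (q * sqrt e) ^ 3" by simp
  \<comment> \<open>The cubes are compared by contraposition: \<open>?l\<close> may have either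
    sign, but \<open>q * sqrt e < - ?l\<close> puts both bases on the nonnegative side.\<close>
  moreover have "(q * sqrt e) ^ 3 < (- ?l) ^ 3" if "q * sqrt e < - ?l"
    using that q e by (intro power_strict_mono) auto
  ultimately show "- (q * sqrt e) \<le> ?l" by (meson not_le neg_le_iff_le minus_le_iff)
qed

text \<open>\<open>K\<close> is the least count, up to rounding, that makes
  \<open>gap / (K - d)\<close> small enough for \<open>small_progress_measure_imp\<close>, and it is
  fixed before the run. Its part \<open>d + 2\<close> (start index, one extra step, rounding) would
  bring the dimension into the constant; \<open>e0\<close> is chosen so that
  \<open>S >= d + 2\<close>, and the summand 1 in the constant absorbs it.\<close>

lemma c2eden_complexity:
  assumes problem: "problem_instance d n F L" and x0: "x0 \<in> carrier_vec d"
  defines "f \<equiv> objective n F"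
  shows "\<exists>e0>0. \<forall>e. 0 < e \<and> e < e0 \<longrightarrow>
    (\<exists>K. real K \<le> (93312 * (f x0 - f_star d f) + 1) * sqrt (real d * L) * e powr (- 3 / 2) \<and>
      (\<forall>x. c2eden d n F (12 * real d * L) x0 x \<longrightarrow>
        (\<exists>i. d < i \<and> i \<le> K \<and> vnorm (grad d f (x i)) \<le> e \<and>
          - sqrt (real d * L * e) \<le> lambda_min (hess d f (x i)))))"
proof -
  define q where "q = sqrt (real d * L)"
  define gap where "gap = f x0 - f_star d f"
  have dL: "0 < real d * L" using problem_dims[OF problem] by simp
  then have q: "0 < q" "q\<^sup>2 = real d * L" by (simp_all add: q_def)
  have M: "12 * real d * L = 12 * q\<^sup>2" by (simp add: q)
  have gap: "0 \<le> gap"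
    using problem x0 unfolding gap_def f_def f_star_def
    by (auto simp: problem_instance_def intro: cINF_lower)
  define e0 where "e0 = (q / (real d + 2)) powr (2 / 3)"
  show ?thesis
  proof (rule exI[of _ e0], intro conjI allI impI)
    show "0 < e0" using q by (simp add: e0_def)
    fix e :: real assume e: "0 < e \<and> e < e0"
    define S where "S = q * e powr (- 3 / 2)"
    have S: "0 < S" using q e by (simp add: S_def)
    have "sqrt e ^ 3 = e powr (3 / 2)" using e by (simp add: powr_three_halves)
    then have S': "sqrt e ^ 3 / q = 1 / S"
      by (simp add: S_def powr_minus_divide)
    have "e powr (3 / 2) \<le> e0 powr (3 / 2)" using e by (intro powr_mono2) auto
    also have "e0 powr (3 / 2) = q / (real d + 2)" using q by (simp add: e0_def powr_powr)
    finally have large: "real d + 2 \<le> S"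
      using q e by (simp add: S_def powr_minus_divide field_simps)
    \<comment> \<open>The 1 ensures \<open>d < K\<close> even when \<open>gap = 0\<close>.\<close>
    define K where "K = d + 1 + nat \<lceil>93312 * gap * S\<rceil>"
    have K: "d < K" "93312 * gap * S \<le> real (K - d)" using real_nat_ceiling_ge[of "93312 * gap * S"] by (simp_all add: K_def)
    have "real (nat \<lceil>93312 * gap * S\<rceil>) \<le> 93312 * gap * S + 1"
      using gap S by (simp add: of_nat_nat)
    then have "real K \<le> 93312 * gap * S + S" using large by (simp add: K_def)
    then have bound: "real K \<le> (93312 * gap + 1) * q * e powr (- 3 / 2)"
      by (simp add: S_def algebra_simps)
    have "\<exists>i. d < i \<and> i \<le> K \<and> vnorm (grad d f (x i)) \<le> e \<and>
        - sqrt (real d * L * e) \<le> lambda_min (hess d f (x i))"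
      if run: "c2eden d n F (12 * real d * L) x0 x" for x
    proof -
      let ?p = "\<lambda>i. progress_measure d (12 * real d * L) f (x i)"
      have "(MIN i\<in>{d<..K}. ?p i) \<in> ?p ` {d<..K}" using K by (intro Min_in) auto
      then obtain i where i: "i \<in> {d<..K}" "?p i = (MIN i\<in>{d<..K}. ?p i)" by auto
      have "?p i \<le> gap / real (K - d)"
        using min_progress_measure_le[OF problem x0 run K(1), folded f_def]
        by (simp add: i(2) gap_def)
      also have "\<dots> \<le> 1 / (93312 * S)"
        using K S by (simp add: field_simps)
      also have "\<dots> = sqrt e ^ 3 / (93312 * q)"
        using S' by (simp add: field_simps)
      finally have "vnorm (grad d f (x i)) \<le> e" "- (q * sqrt e) \<le> lambda_min (hess d f (x i))"
        using small_progress_measure_imp[OF q(1) _ M] e by auto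
      with i(1) show ?thesis by (auto simp: q_def real_sqrt_mult)
    qed
    with bound show "\<exists>K. real K \<le> (93312 * (f x0 - f_star d f) + 1) * sqrt (real d * L) * e powr (- 3 / 2) \<and>
      (\<forall>x. c2eden d n F (12 * real d * L) x0 x \<longrightarrow>
        (\<exists>i. d < i \<and> i \<le> K \<and> vnorm (grad d f (x i)) \<le> e \<and>
          - sqrt (real d * L * e) \<le> lambda_min (hess d f (x i))))"
      unfolding q_def gap_def by blast
  qed
qed

theorem theorem3p5:
  shows
    "(\<forall>(d::nat) (n::nat) (F :: nat \<Rightarrow> real vec \<Rightarrow> real) (L::real) (x0 :: real vec)
       (x :: nat \<Rightarrow> real vec) (K::nat).
       problem_instance d n F L \<and> x0 \<in> carrier_vec d \<and>
       c2eden d n F (12 * real d * L) x0 x \<and> d < K \<longrightarrow>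
       (MIN i\<in>{d<..K}. progress_measure d (12 * real d * L) (objective n F) (x i))
         \<le> (objective n F x0 - f_star d (objective n F)) / real (K - d))
     \<and>
     (\<exists>C :: real \<Rightarrow> real.
       \<forall>(d::nat) (n::nat) (F :: nat \<Rightarrow> real vec \<Rightarrow> real) (L::real) (x0 :: real vec).
       problem_instance d n F L \<and> x0 \<in> carrier_vec d \<longrightarrow>
       (\<exists>\<epsilon>\<^sub>0>0. \<forall>\<epsilon>::real. 0 < \<epsilon> \<and> \<epsilon> < \<epsilon>\<^sub>0 \<longrightarrow>
         (\<exists>K::nat.
            real K \<le> C (objective n F x0 - f_star d (objective n F))
                       * sqrt (real d * L) * \<epsilon> powr (- 3 / 2) \<and>
            (\<forall>x. c2eden d n F (12 * real d * L) x0 x \<longrightarrow>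
               (\<exists>i. d < i \<and> i \<le> K \<and>
                  vnorm (grad d (objective n F) (x i)) \<le> \<epsilon> \<and>
                  lambda_min (hess d (objective n F) (x i)) \<ge> - sqrt (real d * L * \<epsilon>))))))"
proof (intro conjI exI[of _ "\<lambda>gap. 93312 * gap + 1"] allI impI; elim conjE)
qed (rule min_progress_measure_le c2eden_complexity; assumption)+

end
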